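(* For all $k\ge 1$, there exists a polynomial-time algorithm that, given any CSP instance $\mathbf{A},\mathbf{B}$, either (1) outputs a satisfying assignment for $\mathbf{A},\mathbf{B}$, (2) correctly reports that $\mathbf{A},\mathbf{B}$ is unsatisfiable, or (3) reports ``I don't know''; and on every instance of $\mathsf{CSP}[\mathsf{coverwidth}\le k]$ the algorithm performs (1) or (2).
   Context: A CSP instance is a pair $\mathbf{A},\mathbf{B}$ of finite relational structures over the same finite relational signature; a satisfying assignment is a homomorphism from $\mathbf{A}$ to $\mathbf{B}$ (a map $h:A\to B$ with $(h(a_1),\ldots,h(a_r))\in R^{\mathbf{B}}$ for all $(a_1,\ldots,a_r)\in R^{\mathbf{A}}$), and the instance is satisfiable if one exists. $H(\mathbf{A})$ is the hypergraph on $A$ with a hyperedge $\{a_1,\ldots,a_r\}$ per tuple of any relation of $\mathbf{A}$. A $k$-union is a union of $k$ hyperedges (the empty set being the $0$-union); the weight of $X\subseteq A$ is the least $k\ge0$ with $X\cap\bigcup_e e$ contained in a $k$-union. A tree decomposition of $H(\mathbf{A})$ is a tree with bags $X_i\subseteq A$ covering $A$, each hyperedge inside some bag, and for each vertex the bags containing it forming a connected subtree; its weight is its maximal bag weight; the coverwidth of $\mathbf{A}$ is the minimal weight of a tree decomposition. $\mathsf{CSP}[\mathsf{coverwidth}\le k]$ is the set of CSP instances $\mathbf{A},\mathbf{B}$ with $\mathbf{A}$ of coverwidth $\le k$. *)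

theory Defs
  imports "HOL-Computational_Algebra.Polynomial"
begin

section \<open>Relational structures and CSP instances\<close>

text \<open>A signature is the list of the arities of its relation symbols; the symbols are the
  positions in this list, and \<open>rels A ! i\<close> interprets symbol \<open>i\<close>.  Arity 0 and empty universes
  are allowed.\<close>

type_synonym signature = "nat list"

record 'a rel_structure =
  univ :: "'a set"
  rels :: "'a list set list"

definition finite_structure :: "signature \<Rightarrow> 'a rel_structure \<Rightarrow> bool" where
  "finite_structure \<sigma> A \<longleftrightarrow>
     finite (univ A) \<and> length (rels A) = length \<sigma> \<and>
     (\<forall>i<length \<sigma>. \<forall>t\<in>rels A ! i. length t = \<sigma> ! i \<and> set t \<subseteq> univ A)"

definition homomorphism :: "'a rel_structure \<Rightarrow> 'b rel_structure \<Rightarrow> ('a \<Rightarrow> 'b) \<Rightarrow> bool" where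
  "homomorphism A B h \<longleftrightarrow>
     h ` univ A \<subseteq> univ B \<and> (\<forall>i<length (rels A). \<forall>t\<in>rels A ! i. map h t \<in> rels B ! i)"

type_synonym csp_instance = "signature \<times> nat rel_structure \<times> nat rel_structure"

definition CSP :: "csp_instance set" where
  "CSP = {(\<sigma>, A, B). finite_structure \<sigma> A \<and> finite_structure \<sigma> B}"

fun satisfiable :: "csp_instance \<Rightarrow> bool" where
  "satisfiable (\<sigma>, A, B) \<longleftrightarrow> (\<exists>h. homomorphism A B h)"


section \<open>Coverwidth\<close>

definition hyperedges :: "'a rel_structure \<Rightarrow> 'a set set" where
  "hyperedges A = {set t |i t. i < length (rels A) \<and> t \<in> rels A ! i}"

definition is_k_union :: "'a set set \<Rightarrow> nat \<Rightarrow> 'a set \<Rightarrow> bool" where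
  "is_k_union H k U \<longleftrightarrow> (\<exists>F\<subseteq>H. finite F \<and> card F = k \<and> U = \<Union>F)"

definition weight :: "'a set set \<Rightarrow> 'a set \<Rightarrow> nat" where
  "weight H X = (LEAST k. \<exists>U. is_k_union H k U \<and> X \<inter> \<Union>H \<subseteq> U)"

definition connected_in :: "'v set set \<Rightarrow> 'v set \<Rightarrow> bool" where
  "connected_in E S \<longleftrightarrow>
     (\<forall>u\<in>S. \<forall>v\<in>S. (u, v) \<in> {(x, y). x \<in> S \<and> y \<in> S \<and> {x, y} \<in> E}\<^sup>*)"

definition is_cycle :: "'v set set \<Rightarrow> 'v list \<Rightarrow> bool" where
  "is_cycle E c \<longleftrightarrow>
     3 \<le> length c \<and> distinct c \<and>
     (\<forall>i. Suc i < length c \<longrightarrow> {c ! i, c ! Suc i} \<in> E) \<and> {last c, hd c} \<in> E"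

definition is_tree :: "'v set \<Rightarrow> 'v set set \<Rightarrow> bool" where
  "is_tree V E \<longleftrightarrow>
     finite V \<and> V \<noteq> {} \<and>
     (\<forall>e\<in>E. \<exists>u v. e = {u, v} \<and> u \<in> V \<and> v \<in> V \<and> u \<noteq> v) \<and>
     connected_in E V \<and> (\<nexists>c. is_cycle E c)"

definition tree_decomposition ::
  "'a rel_structure \<Rightarrow> 'v set \<Rightarrow> 'v set set \<Rightarrow> ('v \<Rightarrow> 'a set) \<Rightarrow> bool" where
  "tree_decomposition A V E X \<longleftrightarrow>
     is_tree V E \<and>
     (\<Union>v\<in>V. X v) = univ A \<and>
     (\<forall>e\<in>hyperedges A. \<exists>v\<in>V. e \<subseteq> X v) \<and>
     (\<forall>a\<in>univ A. connected_in E {v \<in> V. a \<in> X v})"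

definition decomposition_weight :: "'a rel_structure \<Rightarrow> 'v set \<Rightarrow> ('v \<Rightarrow> 'a set) \<Rightarrow> nat" where
  "decomposition_weight A V X = Max ((\<lambda>v. weight (hyperedges A) (X v)) ` V)"

text \<open>Up to renaming, the nodes of a finite tree are natural numbers.\<close>

definition coverwidth :: "'a rel_structure \<Rightarrow> nat" where
  "coverwidth A =
     (LEAST w. \<exists>(V :: nat set) E X. tree_decomposition A V E X \<and> w = decomposition_weight A V X)"

definition CSP_coverwidth_le :: "nat \<Rightarrow> csp_instance set" where
  "CSP_coverwidth_le k = {(\<sigma>, A, B) \<in> CSP. coverwidth A \<le> k}"


section \<open>Algorithms and running time\<close>

text \<open>The machine model is a first-order functional language over binary trees, in the style
  of the languages F and WHILE of N. D. Jones (Computability and Complexity from a Programming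
  Perspective), with unit cost for every evaluated subexpression.
  An evaluation step allocates at most one cell, inspects at most one cell, and
  pushes at most one frame, whose number of entries is bounded by the (fixed) program.
  Hence, with shared subtrees, \<open>t\<close> steps can be simulated by a Turing machine in time polynomial
  in \<open>t\<close> and the input size; conversely, Turing machines are simulated with constant-factor overhead.
  Thus polynomial time has its usual meaning.\<close>

datatype data = Leaf | Node data data

fun left :: "data \<Rightarrow> data" where
  "left Leaf = Leaf"
| "left (Node x y) = x"

fun right :: "data \<Rightarrow> data" where
  "right Leaf = Leaf"
| "right (Node x y) = y"

text \<open>Variables are de Bruijn indices into the list of arguments and let-bound values.
  A program is a list of function bodies; functions may call each other recursively.\<close>

datatype expr =
    EVar nat
  | ELeaf
  | ENode expr expr
  | ELeft expr
  | ERight expr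
  | EIf expr expr expr
  | ELet expr expr
  | ECall nat "expr list"

type_synonym program = "expr list"

text \<open>\<open>eval P env e v t\<close>: in environment \<open>env\<close>, expression \<open>e\<close> evaluates to \<open>v\<close> in \<open>t\<close> steps.
  Divergence is the absence of a derivation.\<close>

inductive eval :: "program \<Rightarrow> data list \<Rightarrow> expr \<Rightarrow> data \<Rightarrow> nat \<Rightarrow> bool"
  and evals :: "program \<Rightarrow> data list \<Rightarrow> expr list \<Rightarrow> data list \<Rightarrow> nat \<Rightarrow> bool"
  for P :: program
where
  eval_var: "n < length env \<Longrightarrow> eval P env (EVar n) (env ! n) 1"
| eval_leaf: "eval P env ELeaf Leaf 1"
| eval_node: "eval P env e1 v1 t1 \<Longrightarrow> eval P env e2 v2 t2 \<Longrightarrow>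
    eval P env (ENode e1 e2) (Node v1 v2) (t1 + t2 + 1)"
| eval_left: "eval P env e v t \<Longrightarrow> eval P env (ELeft e) (left v) (t + 1)"
| eval_right: "eval P env e v t \<Longrightarrow> eval P env (ERight e) (right v) (t + 1)"
| eval_if_node: "eval P env e v t \<Longrightarrow> v \<noteq> Leaf \<Longrightarrow> eval P env e1 v1 t1 \<Longrightarrow>
    eval P env (EIf e e1 e2) v1 (t + t1 + 1)"
| eval_if_leaf: "eval P env e Leaf t \<Longrightarrow> eval P env e2 v2 t2 \<Longrightarrow>
    eval P env (EIf e e1 e2) v2 (t + t2 + 1)"
| eval_let: "eval P env e1 v1 t1 \<Longrightarrow> eval P (v1 # env) e2 v2 t2 \<Longrightarrow>
    eval P env (ELet e1 e2) v2 (t1 + t2 + 1)"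
| eval_call: "evals P env es vs t1 \<Longrightarrow> f < length P \<Longrightarrow> eval P vs (P ! f) v t2 \<Longrightarrow>
    eval P env (ECall f es) v (t1 + t2 + 1)"
| evals_nil: "evals P env [] [] 0"
| evals_cons: "eval P env e v t1 \<Longrightarrow> evals P env es vs t2 \<Longrightarrow>
    evals P env (e # es) (v # vs) (t1 + t2)"

lemma eval_deterministic:
  "eval P env e v t \<Longrightarrow> eval P env e v' t' \<Longrightarrow> v' = v \<and> t' = t"
  "evals P env es vs t \<Longrightarrow> evals P env es vs' t' \<Longrightarrow> vs' = vs \<and> t' = t"
proof (induction arbitrary: v' t' and vs' t' rule: eval_evals.inducts)
  case (eval_var n env)
  then show ?case by (auto elim: eval.cases)
next
  case (eval_leaf env)
  then show ?case by (auto elim: eval.cases)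
next
  case (eval_node env e1 v1 t1 e2 v2 t2)
  from eval_node.prems show ?case
    by (cases rule: eval.cases) (use eval_node.IH in blast)+
next
  case (eval_left env e v t)
  from eval_left.prems show ?case
    by (cases rule: eval.cases) (use eval_left.IH in blast)+
next
  case (eval_right env e v t)
  from eval_right.prems show ?case
    by (cases rule: eval.cases) (use eval_right.IH in blast)+
next
  case (eval_if_node env e v t e1 v1 t1 e2)
  from eval_if_node.prems show ?case
    by (cases rule: eval.cases) (use eval_if_node.IH eval_if_node.hyps in blast)+
next
  case (eval_if_leaf env e t e2 v2 t2 e1)
  from eval_if_leaf.prems show ?case
    by (cases rule: eval.cases) (use eval_if_leaf.IH in blast)+
next
  case (eval_let env e1 v1 t1 e2 v2 t2)
  from eval_let.prems show ?case
    by (cases rule: eval.cases) (use eval_let.IH in blast)+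
next
  case (eval_call env es vs t1 f v t2)
  from eval_call.prems show ?case
    by (cases rule: eval.cases) (use eval_call.IH in blast)+
next
  case (evals_nil env)
  then show ?case by (auto elim: evals.cases)
next
  case (evals_cons env e v t1 es vs t2)
  from evals_cons.prems show ?case
    by (cases rule: evals.cases) (use evals_cons.IH in blast)+
qed

definition runs :: "program \<Rightarrow> data \<Rightarrow> data \<Rightarrow> nat \<Rightarrow> bool" where
  "runs P x y t \<longleftrightarrow> P \<noteq> [] \<and> eval P [x] (hd P) y t"

text \<open>The input size \<open>size x\<close> is the number of \<open>Node\<close> cells of \<open>x\<close>.\<close>

definition polynomial_time_on :: "data set \<Rightarrow> program \<Rightarrow> bool" where
  "polynomial_time_on D P \<longleftrightarrow>
     (\<exists>p :: nat poly. \<forall>x\<in>D. \<exists>y t. runs P x y t \<and> t \<le> poly p (size x))"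


section \<open>Encoding of inputs and outputs\<close>

fun enc_list :: "('a \<Rightarrow> data) \<Rightarrow> 'a list \<Rightarrow> data" where
  "enc_list f [] = Leaf"
| "enc_list f (x # xs) = Node (f x) (enc_list f xs)"

definition enc_bool :: "bool \<Rightarrow> data" where
  "enc_bool b = (if b then Node Leaf Leaf else Leaf)"

text \<open>Binary, least significant bit first.\<close>

fun enc_nat :: "nat \<Rightarrow> data" where
  "enc_nat n = (if n = 0 then Leaf else Node (enc_bool (odd n)) (enc_nat (n div 2)))"

declare enc_nat.simps [simp del]

text \<open>The universe and the relations are listed explicitly, in an arbitrary order.\<close>

definition encodes_structure :: "nat rel_structure \<Rightarrow> data \<Rightarrow> bool" where
  "encodes_structure A x \<longleftrightarrow>
     (\<exists>us rs. distinct us \<and> set us = univ A \<and>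
        list_all2 (\<lambda>ts R. distinct ts \<and> set ts = R) rs (rels A) \<and>
        x = Node (enc_list enc_nat us) (enc_list (enc_list (enc_list enc_nat)) rs))"

fun encodes_instance :: "csp_instance \<Rightarrow> data \<Rightarrow> bool" where
  "encodes_instance (\<sigma>, A, B) x \<longleftrightarrow>
     (\<exists>a b. encodes_structure A a \<and> encodes_structure B b \<and>
        x = Node (enc_list enc_nat \<sigma>) (Node a b))"

text \<open>An assignment is output as the list of its argument-value pairs.\<close>

datatype answer = Assignment "(nat \<times> nat) list" | Unsatisfiable | Dont_Know

fun enc_answer :: "answer \<Rightarrow> data" where
  "enc_answer Dont_Know = Leaf"
| "enc_answer Unsatisfiable = Node Leaf Leaf"
| "enc_answer (Assignment ps) =
     Node (Node Leaf Leaf) (enc_list (\<lambda>(a, b). Node (enc_nat a) (enc_nat b)) ps)"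

lemma inj_enc_list: "inj f \<Longrightarrow> inj (enc_list f)"
proof (rule injI)
  fix xs ys assume "inj f" "enc_list f xs = enc_list f ys"
  then show "xs = ys"
  proof (induction xs arbitrary: ys)
    case Nil then show ?case by (cases ys) auto
  next
    case (Cons x xs) then show ?case by (cases ys) (auto dest: injD)
  qed
qed

lemma inj_enc_nat: "inj enc_nat"
proof (rule injI)
  fix m n assume "enc_nat m = enc_nat n"
  then show "m = n"
  proof (induction m arbitrary: n rule: less_induct)
    case (less m)
    show ?case
    proof (cases "m = 0 \<or> n = 0")
      case True
      with less.prems show ?thesis
        by (auto simp: enc_nat.simps[of m] enc_nat.simps[of n] enc_nat.simps[of 0]
            split: if_splits)
    next
      case False
      with less.prems have "enc_nat (m div 2) = enc_nat (n div 2)" "odd m = odd n"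
        by (auto simp: enc_nat.simps[of m] enc_nat.simps[of n] enc_bool_def split: if_splits)
      with less.IH[of "m div 2" "n div 2"] False have "m div 2 = n div 2" "m mod 2 = n mod 2"
        by (auto simp: odd_iff_mod_2_eq_one)
      then show ?thesis by (metis div_mult_mod_eq)
    qed
  qed
qed

lemma inj_enc_answer: "inj enc_answer"
proof -
  have "inj (\<lambda>(a, b). Node (enc_nat a) (enc_nat b))"
    using inj_enc_nat by (auto simp: inj_def)
  from inj_enc_list[OF this] have *: "enc_list (\<lambda>(a, b). Node (enc_nat a) (enc_nat b)) ps =
      enc_list (\<lambda>(a, b). Node (enc_nat a) (enc_nat b)) qs \<longleftrightarrow> ps = qs" for ps qs
    by (auto dest: injD)
  show ?thesis
  proof (rule injI)
    fix x y assume "enc_answer x = enc_answer y"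
    then show "x = y" by (cases x; cases y) (auto simp: *)
  qed
qed

definition satisfying_assignment :: "csp_instance \<Rightarrow> (nat \<times> nat) list \<Rightarrow> bool" where
  "satisfying_assignment I ps \<longleftrightarrow>
     (case I of (\<sigma>, A, B) \<Rightarrow>
        distinct (map fst ps) \<and> set (map fst ps) = univ A \<and>
        homomorphism A B (\<lambda>a. the (map_of ps a)))"

fun correct_answer :: "csp_instance \<Rightarrow> answer \<Rightarrow> bool" where
  "correct_answer I (Assignment ps) \<longleftrightarrow> satisfying_assignment I ps"
| "correct_answer I Unsatisfiable \<longleftrightarrow> \<not> satisfiable I"
| "correct_answer I Dont_Know \<longleftrightarrow> True"

end

theory Submission
  imports Defs
begin

text \<open>View the instance as a list of constraints.  The algorithm keeps, for every sequence of
  \<open>k\<close> constraints, the joint choices of image tuples, and deletes a choice as long as some other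
  sequence has no choice agreeing with it on common arguments; the instance is inconsistent once a
  sequence runs out of choices.  A homomorphism provides choices that are never deleted.
  Conversely, if the coverwidth is at most \<open>k\<close>, every bag of a suitable tree decomposition is
  covered by \<open>k\<close> constraints, and surviving choices picked along the tree, each agreeing with its
  neighbours, glue to a homomorphism.  The test also works relative to pinned values of
  some arguments, so a homomorphism is found by pinning the arguments one after the other; a total
  pinning that passes the test is a homomorphism whatever the coverwidth.\<close>

section \<open>Polynomial-time computable functions\<close>

text \<open>The algorithm never computes a tree decomposition; one occurs only in the correctness
  proof. This is why a homomorphism has to be extracted by pinning, with nothing but repeated tests.
  Pins only delete choices and add no tuple to the left structure, so its hypergraph, and with it
  the coverwidth, stays the same throughout. \<open>Dont_Know\<close> arises when the right universe
  is nonempty and the pins pass the test but no value for the next argument does; bounded coverwidth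
  excludes this, since pins that pass then extend to a homomorphism. As \<open>k\<close> is fixed,
  the number of groups and the number of choices in a group are polynomial. Turning this into a step
  count is the main technical obstacle. No program is written for the whole algorithm: a class of
  functions closed under composition, branching and the usual list operations is established, and
  the algorithm is an ordinary function composed of these.\<close>

lemma poly_nat_mono: "m \<le> n \<Longrightarrow> poly p m \<le> poly p n" for p :: "nat poly"
  by (induction p) (auto intro: add_mono mult_mono)

text \<open>Injectivity lets an equality test on trees decide equality of the encoded
  values.\<close>

class encodable =
  fixes encode :: "'a \<Rightarrow> data"
  assumes inj_encode: "inj encode"
begin

lemma encode_eq_iff [simp]: "encode x = encode y \<longleftrightarrow> x = y"
  using inj_encode by (auto dest: injD)

abbreviation esize :: "'a \<Rightarrow> nat" where
  "esize x \<equiv> size (encode x)"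

end

instantiation nat :: encodable
begin
definition "encode = enc_nat"
instance by standard (simp add: encode_nat_def inj_enc_nat)
end

instantiation bool :: encodable
begin
definition "encode = enc_bool"
instance by standard (auto simp: encode_bool_def enc_bool_def inj_def split: if_splits)
end

instantiation list :: (encodable) encodable
begin
definition "encode = enc_list encode"
instance by standard (simp add: encode_list_def inj_enc_list inj_encode)
end

instantiation prod :: (encodable, encodable) encodable
begin
definition "encode z = Node (encode (fst z)) (encode (snd z))"
instance by standard (auto simp: encode_prod_def inj_def)
end

instantiation answer :: encodable
begin
definition "encode = enc_answer"
instance by standard (simp add: encode_answer_def inj_enc_answer)
end

lemma encode_simps [simp]:
  "encode True = Node Leaf Leaf"
  "encode False = Leaf"
  "encode [] = Leaf"
  "encode (y # ys) = Node (encode y) (encode ys)"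
  "encode (a, b) = Node (encode a) (encode b)"
  by (auto simp: encode_bool_def enc_bool_def encode_list_def encode_prod_def)

lemma encode_eq_Leaf_iff [simp]:
  "encode b = Leaf \<longleftrightarrow> \<not> b"
  "encode xs = Leaf \<longleftrightarrow> xs = []"
  by (cases b; simp) (cases xs; simp)

lemma esize_bool: "esize (b :: bool) \<le> 1"
  by (cases b) auto

lemma length_le_esize: "length xs \<le> esize xs"
  by (induction xs) auto

lemma esize_member: "y \<in> set ys \<Longrightarrow> esize y < esize ys"
  by (induction ys) auto

section \<open>Evaluation in larger programs, and linking\<close>

lemma eval_cong: "eval P env e v t \<Longrightarrow> v = v' \<Longrightarrow> t = t' \<Longrightarrow> eval P env e v' t'"
  by simp

text \<open>Appending functions to the table or values to the environment leaves all indices in use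
  unchanged. This allows an expression to run with unrelated values behind its argument.\<close>

lemma eval_weaken:
  "eval P env e v t \<Longrightarrow> eval (P @ Q) (env @ env') e v t"
  "evals P env es vs t \<Longrightarrow> evals (P @ Q) (env @ env') es vs t"
proof (induction arbitrary: env' and env' rule: eval_evals.inducts)
  case (eval_var n env)
  then show ?case using eval_evals.eval_var[of n "env @ env'" "P @ Q"] by (simp add: nth_append)
next
  case (eval_let env e1 v1 t1 e2 v2 t2)
  then show ?case by (metis append_Cons eval_evals.eval_let)
next
  case (eval_call env es vs t1 f v t2)
  \<comment> \<open>A callee sees only its arguments, so the longer environment does not reach it
    and the induction hypothesis is used with no extra values.\<close>
  have "f < length P" "eval (P @ Q) (vs @ []) (P ! f) v t2"
    "evals (P @ Q) (env @ env') es vs t1" by fact+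
  then show ?case by (intro eval_evals.eval_call) (auto simp: nth_append)
qed (auto intro: eval_evals.intros[simplified])

lemma eval_extend: "eval P env e v t \<Longrightarrow> eval (P @ Q) env e v t"
  using eval_weaken(1)[of P env e v t Q "[]"] by simp

text \<open>Relocation of code: a function table placed behind \<open>n\<close> other functions must
  have its calls renumbered.\<close>

fun shift :: "nat \<Rightarrow> expr \<Rightarrow> expr" where
  "shift n (EVar i) = EVar i"
| "shift n ELeaf = ELeaf"
| "shift n (ENode e1 e2) = ENode (shift n e1) (shift n e2)"
| "shift n (ELeft e) = ELeft (shift n e)"
| "shift n (ERight e) = ERight (shift n e)"
| "shift n (EIf e e1 e2) = EIf (shift n e) (shift n e1) (shift n e2)"
| "shift n (ELet e1 e2) = ELet (shift n e1) (shift n e2)"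
| "shift n (ECall f es) = ECall (n + f) (map (shift n) es)"

lemma eval_shift:
  "eval Q env e v t \<Longrightarrow> eval (P @ map (shift (length P)) Q) env (shift (length P) e) v t"
  "evals Q env es vs t \<Longrightarrow>
    evals (P @ map (shift (length P)) Q) env (map (shift (length P)) es) vs t"
proof (induction rule: eval_evals.inducts)
  case (eval_call env es vs t1 f v t2)
  then show ?case
    using eval_evals.eval_call[of "P @ map (shift (length P)) Q" env "map (shift (length P)) es" vs t1
        "length P + f" v t2] by (simp add: nth_append)
qed (auto intro: eval_evals.intros[simplified])

text \<open>The expression \<open>e\<close> stays outside the table \<open>Q\<close>, so that
  several functions can share one table and be combined by expression constructors.\<close>

definition implements :: "program \<Rightarrow> expr \<Rightarrow> nat poly \<Rightarrow> ('a::encodable \<Rightarrow> 'b::encodable) \<Rightarrow> bool"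
  where
  "implements Q e p f \<longleftrightarrow> (\<forall>x. \<exists>t. eval Q [encode x] e (encode (f x)) t \<and>
     t \<le> poly p (esize x) \<and> esize (f x) \<le> poly p (esize x))"

text \<open>The output size must be bounded separately, since sharing lets the language build trees of
  size exponential in the running time.\<close>

definition polytime :: "('a::encodable \<Rightarrow> 'b::encodable) \<Rightarrow> bool" where
  "polytime f \<longleftrightarrow> (\<exists>Q e p. implements Q e p f)"

lemma implementsE:
  assumes "implements Q e p f"
  obtains t where "eval Q [encode x] e (encode (f x)) t" "t \<le> poly p (esize x)"
    "esize (f x) \<le> poly p (esize x)"
  using assms unfolding implements_def by blast

lemma polytimeI:
  assumes "\<And>x. \<exists>t. eval Q [encode x] e (encode (f x)) t \<and>
     t \<le> poly p (esize x) \<and> esize (f x) \<le> poly p (esize x)"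
  shows "polytime f"
  using assms unfolding polytime_def implements_def by blast

lemma implements_mono:
  fixes f :: "'a::encodable \<Rightarrow> 'b::encodable"
  assumes "implements Q e p f"
  shows "implements (Q @ R) e (p + q) f"
  unfolding implements_def
proof
  fix x :: 'a
  obtain t where "eval Q [encode x] e (encode (f x)) t" "t \<le> poly p (esize x)"
    "esize (f x) \<le> poly p (esize x)" by (rule implementsE[OF assms])
  then show "\<exists>t. eval (Q @ R) [encode x] e (encode (f x)) t \<and>
      t \<le> poly (p + q) (esize x) \<and> esize (f x) \<le> poly (p + q) (esize x)"
    by (intro exI[of _ t]) (auto intro: eval_extend)
qed

lemma implements_shift:
  fixes f :: "'a::encodable \<Rightarrow> 'b::encodable"
  assumes "implements Q e p f"
  shows "implements (R @ map (shift (length R)) Q) (shift (length R) e) (q + p) f"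
  unfolding implements_def
proof
  fix x :: 'a
  obtain t where "eval Q [encode x] e (encode (f x)) t" "t \<le> poly p (esize x)"
    "esize (f x) \<le> poly p (esize x)" by (rule implementsE[OF assms])
  then show "\<exists>t. eval (R @ map (shift (length R)) Q) [encode x] (shift (length R) e)
        (encode (f x)) t \<and>
      t \<le> poly (q + p) (esize x) \<and> esize (f x) \<le> poly (q + p) (esize x)"
    by (intro exI[of _ t]) (auto intro: eval_shift)
qed

text \<open>The second table is relocated behind the first, and the sum of the two bounds serves
  both functions.\<close>

lemma polytime_link2:
  assumes "polytime f" "polytime g"
  obtains Q e1 e2 p where "implements Q e1 p f" "implements Q e2 p g"
  using assms implements_mono implements_shift unfolding polytime_def by metis

lemma polytime_link3:
  assumes "polytime f" "polytime g" "polytime h"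
  obtains Q e1 e2 e3 p where "implements Q e1 p f" "implements Q e2 p g" "implements Q e3 p h"
proof -
  obtain Q e1 e2 p where "implements Q e1 p f" "implements Q e2 p g"
    using assms polytime_link2 by metis
  moreover obtain R e3 q where "implements R e3 q h"
    using assms polytime_def by metis
  ultimately show thesis using that implements_mono implements_shift by metis
qed

section \<open>Closure properties of the polynomial-time functions\<close>

named_theorems polytime_intros

lemma polytime_id [polytime_intros]: "polytime (\<lambda>x. x)"
  by (rule polytimeI[of "[]" "EVar 0" _ "[:1, 1:]"])
    (use eval_evals.eval_var[of 0 "[_]"] in \<open>force intro!: exI[of _ 1]\<close>)

lemma eval_constant: "\<exists>e t. \<forall>env. eval P env e v t"
proof (induction v)
  case Leaf
  then show ?case using eval_evals.eval_leaf by blast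
next
  case (Node v1 v2)
  then show ?case using eval_evals.eval_node by blast
qed

lemma polytime_const [polytime_intros]: "polytime (\<lambda>x. c)"
proof -
  obtain e t where "\<And>env. eval [] env e (encode c) t"
    using eval_constant by blast
  then show ?thesis
    by (intro polytimeI[of "[]" e _ "[:t + esize c:]"]) (auto intro!: exI[of _ t])
qed

text \<open>The intermediate value has size at most \<open>p\<close> of the input size, which is
  where \<open>pcompose p p\<close> comes from. The bound on output size is what makes this
  work.\<close>

lemma polytime_comp:
  fixes f :: "'b::encodable \<Rightarrow> 'c::encodable" and g :: "'a::encodable \<Rightarrow> 'b"
  assumes "polytime f" "polytime g"
  shows "polytime (\<lambda>x. f (g x))"
proof -
  obtain Q ef eg p where f: "implements Q ef p f" and g: "implements Q eg p g"
    using assms by (rule polytime_link2)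
  show ?thesis
  proof (rule polytimeI)
    fix x :: 'a
    let ?n = "esize x"
    obtain t where t: "eval Q [encode x] eg (encode (g x)) t" "t \<le> poly p ?n" "esize (g x) \<le> poly p ?n"
      by (rule implementsE[OF g])
    obtain s where s: "eval Q [encode (g x)] ef (encode (f (g x))) s" "s \<le> poly p (esize (g x))"
      "esize (f (g x)) \<le> poly p (esize (g x))" by (rule implementsE[OF f])
    have "poly p (esize (g x)) \<le> poly (pcompose p p) ?n"
      using t(3) by (simp add: poly_pcompose poly_nat_mono)
    moreover have "eval Q [encode x] (ELet eg ef) (encode (f (g x))) (t + s + 1)"
      using t(1) eval_weaken(1)[OF s(1), of "[]" "[encode x]"] eval_evals.eval_let by force
    ultimately show "\<exists>t. eval Q [encode x] (ELet eg ef) (encode (f (g x))) t \<and>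
        t \<le> poly (pcompose p p + p + 1) ?n \<and> esize (f (g x)) \<le> poly (pcompose p p + p + 1) ?n"
      using t s by (intro exI[of _ "t + s + 1"]) auto
  qed
qed

lemma polytime_Pair [polytime_intros]:
  fixes f :: "'a::encodable \<Rightarrow> 'b::encodable" and g :: "'a \<Rightarrow> 'c::encodable"
  assumes "polytime f" "polytime g"
  shows "polytime (\<lambda>x. (f x, g x))"
proof -
  obtain Q ef eg p where f: "implements Q ef p f" and g: "implements Q eg p g"
    using assms by (rule polytime_link2)
  show ?thesis
  proof (rule polytimeI)
    fix x :: 'a
    let ?n = "esize x"
    obtain t where t: "eval Q [encode x] eg (encode (g x)) t" "t \<le> poly p ?n" "esize (g x) \<le> poly p ?n"
      by (rule implementsE[OF g])
    obtain s where s: "eval Q [encode x] ef (encode (f x)) s" "s \<le> poly p ?n"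
      "esize (f x) \<le> poly p ?n" by (rule implementsE[OF f])
    show "\<exists>t. eval Q [encode x] (ENode ef eg) (encode (f x, g x)) t \<and>
        t \<le> poly (p + p + 1) ?n \<and> esize (f x, g x) \<le> poly (p + p + 1) ?n"
      using t s eval_evals.eval_node[OF s(1) t(1)] by (intro exI[of _ "s + t + 1"]) auto
  qed
qed

text \<open>The encoding of a nonempty list is that of the pair of its head and tail.\<close>

lemma polytime_Cons [polytime_intros]:
  assumes "polytime f" "polytime g"
  shows "polytime (\<lambda>x. f x # g x)"
  using polytime_Pair[OF assms] unfolding polytime_def implements_def by simp

lemma polytime_Assignment [polytime_intros]:
  assumes "polytime f"
  shows "polytime (\<lambda>x. Assignment (f x))"
proof -
  \<comment> \<open>\<open>enc_answer\<close> tags an assignment with the tree that also encodes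
    \<open>True\<close>.\<close>
  have "encode (Assignment ps) = encode (True, ps)" for ps
    by (auto simp: encode_answer_def encode_list_def encode_nat_def encode_prod_def fun_eq_iff
        intro!: arg_cong[where f = "\<lambda>h. enc_list h ps"])
  then show ?thesis
    using polytime_Pair[OF polytime_const[of True] assms]
    unfolding polytime_def implements_def by simp
qed

lemma polytime_left:
  fixes g :: "'a::encodable \<Rightarrow> 'b::encodable"
  assumes "\<And>z. encode (g z) = left (encode z)"
  shows "polytime g"
proof (rule polytimeI[of "[]" "ELeft (EVar 0)" _ "[:2, 1:]"])
  fix z :: 'a
  have "size (left (encode z)) \<le> esize z" by (cases "encode z") auto
  then show "\<exists>t. eval [] [encode z] (ELeft (EVar 0)) (encode (g z)) t \<and>
      t \<le> poly [:2, 1:] (esize z) \<and> esize (g z) \<le> poly [:2, 1:] (esize z)"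
    using eval_evals.eval_left[OF eval_evals.eval_var[of 0 "[encode z]" "[]"]] assms
    by (intro exI[of _ 2]) (auto simp: numeral_2_eq_2)
qed

lemma polytime_right:
  fixes g :: "'a::encodable \<Rightarrow> 'b::encodable"
  assumes "\<And>z. encode (g z) = right (encode z)"
  shows "polytime g"
proof (rule polytimeI[of "[]" "ERight (EVar 0)" _ "[:2, 1:]"])
  fix z :: 'a
  have "size (right (encode z)) \<le> esize z" by (cases "encode z") auto
  then show "\<exists>t. eval [] [encode z] (ERight (EVar 0)) (encode (g z)) t \<and>
      t \<le> poly [:2, 1:] (esize z) \<and> esize (g z) \<le> poly [:2, 1:] (esize z)"
    using eval_evals.eval_right[OF eval_evals.eval_var[of 0 "[encode z]" "[]"]] assms
    by (intro exI[of _ 2]) (auto simp: numeral_2_eq_2)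
qed

lemma polytime_fst [polytime_intros]: "polytime f \<Longrightarrow> polytime (\<lambda>x. fst (f x))"
  by (rule polytime_comp[of fst]) (auto intro: polytime_left simp: encode_prod_def)

lemma polytime_snd [polytime_intros]: "polytime f \<Longrightarrow> polytime (\<lambda>x. snd (f x))"
  by (rule polytime_comp[of snd]) (auto intro: polytime_right simp: encode_prod_def)

text \<open>Functions of several arguments are treated as functions of nested pairs. The body also
  receives \<open>x\<close>, so that it may refer to the surrounding variables.\<close>

lemma polytime_split [polytime_intros]:
  assumes "polytime f" "polytime (\<lambda>z. h (fst z) (fst (snd z)) (snd (snd z)))"
  shows "polytime (\<lambda>x. case f x of (a, b) \<Rightarrow> h x a b)"
  using polytime_comp[OF assms(2) polytime_Pair[OF polytime_id assms(1)]]
  by (simp add: case_prod_beta)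

lemma polytime_Let [polytime_intros]:
  assumes "polytime f" "polytime (\<lambda>z. g (fst z) (snd z))"
  shows "polytime (\<lambda>x. Let (f x) (g x))"
  using polytime_comp[OF assms(2) polytime_Pair[OF polytime_id assms(1)]]
  by (simp add: Let_def)

lemma polytime_comp2:
  assumes "polytime (\<lambda>z. h (fst z) (snd z))" "polytime f" "polytime g"
  shows "polytime (\<lambda>x. h (f x) (g x))"
  using polytime_comp[OF assms(1) polytime_Pair[OF assms(2,3)]] by simp

lemma polytime_comp3:
  assumes "polytime (\<lambda>z. h (fst z) (fst (snd z)) (snd (snd z)))" "polytime f" "polytime g" "polytime g'"
  shows "polytime (\<lambda>x. h (f x) (g x) (g' x))"
  using polytime_comp[OF assms(1) polytime_Pair[OF assms(2) polytime_Pair[OF assms(3,4)]]] by simp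

lemma polytime_branch:
  fixes f g :: "'a::encodable \<Rightarrow> 'b::encodable" and b :: "'a \<Rightarrow> 'c::encodable"
  assumes "polytime b" "polytime f" "polytime g" and [simp]: "\<And>x. encode (b x) \<noteq> Leaf \<longleftrightarrow> c x"
  shows "polytime (\<lambda>x. if c x then f x else g x)"
proof -
  obtain Q eb ef eg p where b: "implements Q eb p b" and f: "implements Q ef p f"
    and g: "implements Q eg p g"
    using assms(1-3) by (rule polytime_link3)
  show ?thesis
  proof (rule polytimeI)
    fix x :: 'a
    let ?n = "esize x"
    obtain t where t: "eval Q [encode x] eg (encode (g x)) t" "t \<le> poly p ?n" "esize (g x) \<le> poly p ?n"
      by (rule implementsE[OF g])
    obtain s where s: "eval Q [encode x] ef (encode (f x)) s" "s \<le> poly p ?n"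
      "esize (f x) \<le> poly p ?n" by (rule implementsE[OF f])
    obtain r where r: "eval Q [encode x] eb (encode (b x)) r" "r \<le> poly p ?n"
      "esize (b x) \<le> poly p ?n" by (rule implementsE[OF b])
    have "eval Q [encode x] (EIf eb ef eg) (encode (if c x then f x else g x))
        (if c x then r + s + 1 else r + t + 1)"
      using r(1) s(1) t(1) assms(4)[of x] by (cases "c x")
        (auto intro: eval_evals.eval_if_node[simplified] eval_evals.eval_if_leaf[simplified]
          simp del: assms(4))
    then show "\<exists>t. eval Q [encode x] (EIf eb ef eg) (encode (if c x then f x else g x)) t \<and>
        t \<le> poly (p + p + 1) ?n \<and> esize (if c x then f x else g x) \<le> poly (p + p + 1) ?n"
      using t s r by (intro exI[of _ "if c x then r + s + 1 else r + t + 1"]) auto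
  qed
qed

lemma polytime_If [polytime_intros]:
  "polytime c \<Longrightarrow> polytime f \<Longrightarrow> polytime g \<Longrightarrow> polytime (\<lambda>x. if c x then f x else g x)"
  by (rule polytime_branch) auto

lemma polytime_Not [polytime_intros]: "polytime c \<Longrightarrow> polytime (\<lambda>x. \<not> c x)"
  using polytime_If[of c "\<lambda>_. False" "\<lambda>_. True"] by (simp add: polytime_const if_bool_eq_disj)

lemma polytime_conj [polytime_intros]: "polytime c \<Longrightarrow> polytime d \<Longrightarrow> polytime (\<lambda>x. c x \<and> d x)"
  using polytime_If[of c d "\<lambda>_. False"] by (simp add: polytime_const if_bool_eq_disj)

lemma polytime_disj [polytime_intros]: "polytime c \<Longrightarrow> polytime d \<Longrightarrow> polytime (\<lambda>x. c x \<or> d x)"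
  using polytime_If[of c "\<lambda>_. True" d] by (simp add: polytime_const if_bool_eq_disj disj_conj_distribL)

lemma polytime_imp [polytime_intros]: "polytime c \<Longrightarrow> polytime d \<Longrightarrow> polytime (\<lambda>x. c x \<longrightarrow> d x)"
  unfolding imp_conv_disj by (intro polytime_intros)

lemma polytime_list_case [polytime_intros]:
  fixes f :: "'a::encodable \<Rightarrow> 'b::encodable list" and g :: "'a \<Rightarrow> 'c::encodable"
  assumes "polytime f" "polytime g" "polytime (\<lambda>z. h (fst z) (fst (snd z)) (snd (snd z)))"
  shows "polytime (\<lambda>x. case f x of [] \<Rightarrow> g x | y # ys \<Rightarrow> h x y ys)"
proof -
  obtain Q ef eg eh p where f: "implements Q ef p f" and g: "implements Q eg p g"
    and h: "implements Q eh p (\<lambda>z. h (fst z) (fst (snd z)) (snd (snd z)))"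
    using assms by (rule polytime_link3)
  \<comment> \<open>Index 0 holds the list and index 1 holds \<open>x\<close>. A single
    \<open>ENode\<close> builds the argument \<open>(x, y, ys)\<close> of \<open>eh\<close>, and
    \<open>ELet (EVar 1) eg\<close> moves \<open>x\<close> to index 0, where \<open>eg\<close>
    expects it.\<close>
  let ?body = "EIf (EVar 0) (ELet (ENode (EVar 1) (EVar 0)) eh) (ELet (EVar 1) eg)"
  let ?q = "p + p + pcompose p ([:1, 1:] + p) + [:10:]"
  show ?thesis
  proof (rule polytimeI)
    fix x :: 'a
    let ?n = "esize x" and ?v = "encode (case f x of [] \<Rightarrow> g x | y # ys \<Rightarrow> h x y ys)"
    let ?env = "[encode (f x), encode x]"
    obtain r where r: "eval Q [encode x] ef (encode (f x)) r" "r \<le> poly p ?n" "esize (f x) \<le> poly p ?n"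
      by (rule implementsE[OF f])
    have var: "eval Q ?env (EVar 0) (encode (f x)) 1" "eval Q ?env (EVar 1) (encode x) 1"
      using eval_evals.eval_var[of 0 ?env Q] eval_evals.eval_var[of 1 ?env Q] by auto
    have "\<exists>t. eval Q ?env ?body ?v t \<and> t \<le> poly p ?n + poly p (?n + poly p ?n + 1) + 6 \<and>
        size ?v \<le> poly p ?n + poly p (?n + poly p ?n + 1)"
    proof (cases "f x")
      case Nil
      obtain t where t: "eval Q [encode x] eg (encode (g x)) t" "t \<le> poly p ?n" "esize (g x) \<le> poly p ?n"
        by (rule implementsE[OF g])
      have "eval Q (encode x # ?env) eg (encode (g x)) t"
        using eval_weaken(1)[OF t(1), of "[]" ?env] by simp
      from eval_evals.eval_let[OF var(2) this] have "eval Q ?env ?body ?v (1 + (1 + t + 1) + 1)"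
        using var(1) Nil by (intro eval_evals.eval_if_leaf) auto
      then show ?thesis using t Nil by (intro exI) auto
    next
      case (Cons y ys)
      obtain t where t: "eval Q [encode (x, y, ys)] eh (encode (h x y ys)) t"
        "t \<le> poly p (esize (x, y, ys))" "esize (h x y ys) \<le> poly p (esize (x, y, ys))"
        by (rule implementsE[OF h, of "(x, y, ys)"]) auto
      have "eval Q (Node (encode x) (encode (f x)) # ?env) eh (encode (h x y ys)) t"
        using eval_weaken(1)[OF t(1), of "[]" ?env] Cons by simp
      from eval_evals.eval_let[OF eval_evals.eval_node[OF var(2,1)] this]
      have "eval Q ?env ?body ?v (1 + (1 + 1 + 1 + t + 1) + 1)"
        using var(1) Cons by (intro eval_evals.eval_if_node) auto
      moreover have "poly p (esize (x, y, ys)) \<le> poly p (?n + poly p ?n + 1)"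
        using r(3) Cons by (intro poly_nat_mono) auto
      ultimately show ?thesis using t Cons by (intro exI conjI) (assumption, auto)
    qed
    then obtain t where t: "eval Q ?env ?body ?v t"
      "t \<le> poly p ?n + poly p (?n + poly p ?n + 1) + 6"
      "size ?v \<le> poly p ?n + poly p (?n + poly p ?n + 1)" by blast
    show "\<exists>t. eval Q [encode x] (ELet ef ?body) ?v t \<and> t \<le> poly ?q ?n \<and> size ?v \<le> poly ?q ?n"
      using eval_evals.eval_let[OF r(1) t(1)] r t(2,3)
      by (intro exI conjI) (assumption, auto simp: poly_pcompose algebra_simps)
  qed
qed

text \<open>The calls to function 0 are recursive calls in the program \<open>[tree_eq]\<close>.\<close>

definition tree_eq :: expr where
  "tree_eq = EIf (EVar 0)
     (EIf (EVar 1)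
       (EIf (ECall 0 [ELeft (EVar 0), ELeft (EVar 1)])
         (ECall 0 [ERight (EVar 0), ERight (EVar 1)]) ELeaf)
       ELeaf)
     (EIf (EVar 1) ELeaf (ENode ELeaf ELeaf))"

text \<open>Both trees are descended in parallel, so the size of the first alone bounds the time.
  The slope 30 per cell absorbs the additive 10 of the second recursive call and the overhead of one
  round.\<close>

lemma eval_tree_eq:
  "\<exists>t. eval [tree_eq] [a, b] tree_eq (enc_bool (a = b)) t \<and> t \<le> 30 * size a + 10"
proof (induction a arbitrary: b)
  case Leaf
  have var: "eval [tree_eq] [Leaf, b] (EVar 0) Leaf 1" "eval [tree_eq] [Leaf, b] (EVar 1) b 1"
    using eval_evals.eval_var[of 0 "[Leaf, b]"] eval_evals.eval_var[of 1 "[Leaf, b]"] by auto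
  have leaf: "eval [tree_eq] [Leaf, b] ELeaf Leaf 1" by (rule eval_evals.eval_leaf)
  have "eval [tree_eq] [Leaf, b] (EIf (EVar 1) ELeaf (ENode ELeaf ELeaf)) (enc_bool (Leaf = b))
      (if b = Leaf then 1 + (1 + 1 + 1) + 1 else 1 + 1 + 1)"
  proof (cases "b = Leaf")
    case True
    then have "eval [tree_eq] [Leaf, b] (EVar 1) Leaf 1" using var(2) by simp
    from eval_evals.eval_if_leaf[OF this eval_evals.eval_node[OF leaf leaf]] True
    show ?thesis by (simp add: enc_bool_def)
  next
    case False
    then show ?thesis
      using eval_evals.eval_if_node[OF var(2) False leaf] by (simp add: enc_bool_def)
  qed
  from eval_evals.eval_if_leaf[OF var(1) this] have "eval [tree_eq] [Leaf, b] tree_eq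
      (enc_bool (Leaf = b)) (1 + (if b = Leaf then 1 + (1 + 1 + 1) + 1 else 1 + 1 + 1) + 1)"
    unfolding tree_eq_def by simp
  then show ?case by (intro exI conjI) (assumption, auto)
next
  case (Node a1 a2)
  define a where "a = Node a1 a2"
  let ?P = "[tree_eq]"
  have var: "eval ?P [a, b] (EVar 0) a 1" "eval ?P [a, b] (EVar 1) b 1"
    using eval_evals.eval_var[of 0 "[a, b]"] eval_evals.eval_var[of 1 "[a, b]"] by auto
  have leaf: "eval ?P [a, b] ELeaf Leaf 1" by (rule eval_evals.eval_leaf)
  have nz: "a \<noteq> Leaf" by (simp add: a_def)
  show ?case
  proof (cases b)
    case Leaf
    have "eval ?P [a, b] (EVar 1) Leaf 1" using var(2) Leaf by simp
    from eval_evals.eval_if_node[OF var(1) nz eval_evals.eval_if_leaf[OF this leaf]] nz Leaf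
    have "eval ?P [a, b] tree_eq (enc_bool (a = b)) (1 + (1 + 1 + 1) + 1)"
      \<comment> \<open>The first occurrence of \<open>tree_eq\<close> is the one in the function
        table and must stay folded.\<close>
      by (subst (2) tree_eq_def) (simp add: enc_bool_def)
    then show ?thesis unfolding a_def by (intro exI conjI) (assumption, auto)
  next
    case b: (Node b1 b2)
    obtain t1 where t1: "eval ?P [a1, b1] tree_eq (enc_bool (a1 = b1)) t1" "t1 \<le> 30 * size a1 + 10"
      using Node.IH(1) by blast
    obtain t2 where t2: "eval ?P [a2, b2] tree_eq (enc_bool (a2 = b2)) t2" "t2 \<le> 30 * size a2 + 10"
      using Node.IH(2) by blast
    have "evals ?P [a, b] [ELeft (EVar 0), ELeft (EVar 1)] [a1, b1] (1 + 1 + (1 + 1 + 0))"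
      using eval_evals.eval_left[OF var(1)] eval_evals.eval_left[OF var(2)] b
      by (intro eval_evals.evals_cons eval_evals.evals_nil) (simp_all add: a_def)
    then have c1: "eval ?P [a, b] (ECall 0 [ELeft (EVar 0), ELeft (EVar 1)]) (enc_bool (a1 = b1)) (4 + t1 + 1)"
      by (rule eval_cong[OF eval_evals.eval_call]) (use t1(1) in auto)
    have "evals ?P [a, b] [ERight (EVar 0), ERight (EVar 1)] [a2, b2] (1 + 1 + (1 + 1 + 0))"
      using eval_evals.eval_right[OF var(1)] eval_evals.eval_right[OF var(2)] b
      by (intro eval_evals.evals_cons eval_evals.evals_nil) (simp_all add: a_def)
    then have c2: "eval ?P [a, b] (ECall 0 [ERight (EVar 0), ERight (EVar 1)]) (enc_bool (a2 = b2)) (4 + t2 + 1)"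
      by (rule eval_cong[OF eval_evals.eval_call]) (use t2(1) in auto)
    let ?t = "if a1 = b1 then 4 + t1 + 1 + (4 + t2 + 1) + 1 else 4 + t1 + 1 + 1 + 1"
    have "eval ?P [a, b] (EIf (ECall 0 [ELeft (EVar 0), ELeft (EVar 1)])
         (ECall 0 [ERight (EVar 0), ERight (EVar 1)]) ELeaf) (enc_bool (a = b)) ?t"
    proof (cases "a1 = b1")
      case True
      then show ?thesis
        using eval_evals.eval_if_node[OF c1 _ c2] b by (simp add: enc_bool_def a_def)
    next
      case False
      then have "enc_bool (a1 = b1) = Leaf" by (simp add: enc_bool_def)
      from eval_evals.eval_if_leaf[OF c1[unfolded this] leaf] False
      show ?thesis using b by (simp add: enc_bool_def a_def)
    qed
    from eval_evals.eval_if_node[OF var(1) nz eval_evals.eval_if_node[OF var(2) _ this]] b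
    have "eval ?P [a, b] tree_eq (enc_bool (a = b)) (1 + (1 + ?t + 1) + 1)"
      by (subst (2) tree_eq_def) simp
    then show ?thesis using t1(2) t2(2) unfolding a_def
      by (intro exI conjI) (assumption, auto)
  qed
qed

lemma polytime_eq [polytime_intros]:
  fixes f g :: "'a::encodable \<Rightarrow> 'b::encodable"
  assumes "polytime f" "polytime g"
  shows "polytime (\<lambda>x. f x = g x)"
proof (rule polytime_comp2[OF _ assms])
  let ?e = "ECall 0 [ELeft (EVar 0), ERight (EVar 0)]"
  show "polytime (\<lambda>z :: 'b \<times> 'b. fst z = snd z)"
  proof (rule polytimeI)
    fix z :: "'b \<times> 'b"
    let ?P = "[tree_eq]"
    obtain a b where z: "z = (a, b)" by (cases z)
    have var: "eval ?P [encode z] (EVar 0) (encode z) 1"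
      using eval_evals.eval_var[of 0 "[encode z]"] by auto
    obtain t where t: "eval ?P [encode a, encode b] tree_eq (enc_bool (encode a = encode b)) t"
      "t \<le> 30 * esize a + 10" using eval_tree_eq by blast
    have "evals ?P [encode z] [ELeft (EVar 0), ERight (EVar 0)] [encode a, encode b] (1 + 1 + (1 + 1 + 0))"
      using eval_evals.eval_left[OF var] eval_evals.eval_right[OF var] z
      by (intro eval_evals.evals_cons eval_evals.evals_nil) simp_all
    then have "eval ?P [encode z] ?e (encode (fst z = snd z)) (4 + t + 1)"
      by (rule eval_cong[OF eval_evals.eval_call]) (use t(1) in \<open>auto simp: z encode_bool_def\<close>)
    then show "\<exists>t. eval ?P [encode z] ?e (encode (fst z = snd z)) t \<and>
        t \<le> poly [:30, 30:] (esize z) \<and> esize (fst z = snd z) \<le> poly [:30, 30:] (esize z)"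
      using t(2) esize_bool[of "fst z = snd z"] by (intro exI conjI) (assumption, auto simp: z)
  qed
qed


subsection \<open>Recursion on lists\<close>

lemma esize_foldr_le:
  assumes "\<And>y acc. y \<in> set ys \<Longrightarrow> esize (g y acc) \<le> esize acc + d"
  shows "esize (foldr g ys z) \<le> esize z + length ys * d"
  using assms
proof (induction ys)
  case (Cons y ys)
  have "esize (foldr g (y # ys) z) \<le> esize (foldr g ys z) + d" using Cons.prems by simp
  also have "\<dots> \<le> esize z + length ys * d + d" using Cons by simp
  finally show ?case by simp
qed simp

text \<open>The size hypothesis restrains the recursion: without it, iterating a polynomial-time step
  could square the accumulator in every round.\<close>

lemma polytime_foldr:
  fixes f :: "'a::encodable \<Rightarrow> 'b::encodable list" and z :: "'a \<Rightarrow> 'c::encodable"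
  assumes "polytime f" "polytime z" "polytime (\<lambda>u. g (fst u) (fst (snd u)) (snd (snd u)))"
    and growth: "\<And>x y acc. y \<in> set (f x) \<Longrightarrow> esize (g x y acc) \<le> esize acc + poly q (esize x)"
  shows "polytime (\<lambda>x. foldr (g x) (f x) (z x))"
proof -
  obtain Q ef ez eg p where f: "implements Q ef p f" and z: "implements Q ez p z"
    and g: "implements Q eg p (\<lambda>u. g (fst u) (fst (snd u)) (snd (snd u)))"
    using assms(1-3) by (rule polytime_link3)
  let ?r = "length Q"
  \<comment> \<open>The loop becomes function \<open>length Q\<close>, behind the table, and calls
    itself; its arguments are the remaining list and \<open>x\<close>.\<close>
  define body where "body = EIf (EVar 0)
    (ELet (ENode (EVar 1) (ENode (ELeft (EVar 0)) (ECall ?r [ERight (EVar 0), EVar 1]))) eg)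
    (ELet (EVar 1) ez)"
  let ?P = "Q @ [body]"
  \<comment> \<open>\<open>m\<close> bounds every intermediate accumulator, \<open>u\<close> the
    size of the triple passed to \<open>eg\<close>, and \<open>b\<close> the time of one
    round.\<close>
  define m where "m = p + p * q"
  define u where "u = [:2, 1:] + p + m"
  define b where "b = p + pcompose p u + [:20:]"
  show ?thesis
  proof (rule polytimeI)
    fix x :: 'a
    let ?n = "esize x"
    obtain t where t: "eval Q [encode x] ef (encode (f x)) t" "t \<le> poly p ?n" "esize (f x) \<le> poly p ?n"
      by (rule implementsE[OF f])
    obtain s where s: "eval Q [encode x] ez (encode (z x)) s" "s \<le> poly p ?n" "esize (z x) \<le> poly p ?n"
      by (rule implementsE[OF z])
    have len: "length (f x) \<le> poly p ?n" using length_le_esize[of "f x"] t(3) by simp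
    have acc: "esize (foldr (g x) ys (z x)) \<le> poly m ?n"
      if "set ys \<subseteq> set (f x)" "length ys \<le> length (f x)" for ys
    proof -
      have "esize (foldr (g x) ys (z x)) \<le> esize (z x) + length ys * poly q ?n"
        using that growth by (intro esize_foldr_le) auto
      also have "\<dots> \<le> poly p ?n + poly p ?n * poly q ?n"
        using s(3) that(2) len by (intro add_mono mult_mono) auto
      finally show ?thesis by (simp add: m_def)
    qed
    have rec: "\<exists>t. eval ?P [encode ys, encode x] body (encode (foldr (g x) ys (z x))) t \<and>
        t \<le> (length ys + 1) * poly b ?n"
      if "set ys \<subseteq> set (f x)" "length ys \<le> length (f x)" for ys
      using that
    proof (induction ys)
      case Nil
      let ?env = "[encode ([] :: 'b list), encode x]"
      have var: "eval ?P ?env (EVar 0) Leaf 1" "eval ?P ?env (EVar 1) (encode x) 1"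
        using eval_evals.eval_var[of 0 ?env] eval_evals.eval_var[of 1 ?env] by auto
      have "eval ?P (encode x # ?env) ez (encode (z x)) s"
        using eval_weaken(1)[OF s(1), of "[body]" ?env] by simp
      from eval_evals.eval_if_leaf[OF var(1) eval_evals.eval_let[OF var(2) this]]
      have "eval ?P ?env body (encode (foldr (g x) [] (z x))) (1 + (1 + s + 1) + 1)"
        unfolding body_def by simp
      then show ?case using s(2) by (intro exI conjI) (assumption, auto simp: b_def)
    next
      case (Cons y ys)
      let ?env = "[encode (y # ys), encode x]"
      let ?acc = "foldr (g x) ys (z x)"
      obtain t where t: "eval ?P [encode ys, encode x] body (encode ?acc) t"
        "t \<le> (length ys + 1) * poly b ?n" using Cons by auto
      have var: "eval ?P ?env (EVar 0) (encode (y # ys)) 1" "eval ?P ?env (EVar 1) (encode x) 1"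
        using eval_evals.eval_var[of 0 ?env] eval_evals.eval_var[of 1 ?env] by auto
      have "evals ?P ?env [ERight (EVar 0), EVar 1] [encode ys, encode x] (1 + 1 + (1 + 0))"
        using eval_evals.eval_right[OF var(1)] var(2)
        by (intro eval_evals.evals_cons eval_evals.evals_nil) simp_all
      then have call: "eval ?P ?env (ECall ?r [ERight (EVar 0), EVar 1]) (encode ?acc) (3 + t + 1)"
        by (rule eval_cong[OF eval_evals.eval_call]) (use t(1) in auto)
      have head: "eval ?P ?env (ELeft (EVar 0)) (encode y) (1 + 1)"
        using eval_evals.eval_left[OF var(1)] by simp
      obtain r where r: "eval Q [encode (x, y, ?acc)] eg (encode (g x y ?acc)) r"
        "r \<le> poly p (esize (x, y, ?acc))" "esize (g x y ?acc) \<le> poly p (esize (x, y, ?acc))"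
        by (rule implementsE[OF g, of "(x, y, ?acc)"]) auto
      have "eval ?P (encode (x, y, ?acc) # ?env) eg (encode (g x y ?acc)) r"
        using eval_weaken(1)[OF r(1), of "[body]" ?env] by simp
      then have step: "eval ?P ?env (ELet (ENode (EVar 1) (ENode (ELeft (EVar 0))
          (ECall ?r [ERight (EVar 0), EVar 1]))) eg) (encode (g x y ?acc)) (t + r + 10)"
        by (intro eval_cong[OF eval_evals.eval_let[OF eval_evals.eval_node[OF var(2)
              eval_evals.eval_node[OF head call]]]]) auto
      have e: "eval ?P ?env body (encode (foldr (g x) (y # ys) (z x))) (t + r + 12)"
        by (subst (2) body_def, rule eval_cong[OF eval_evals.eval_if_node[OF var(1) _ step]]) auto
      have "esize (x, y, ?acc) \<le> poly u ?n"
        using acc[of ys] Cons.prems esize_member[of y "f x"] \<open>esize (f x) \<le> poly p ?n\<close>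
        by (simp add: u_def)
      then have "r \<le> poly p (poly u ?n)" using r(2) poly_nat_mono order_trans by blast
      then have "t + r + 12 \<le> (length (y # ys) + 1) * poly b ?n"
        using t(2) by (simp add: b_def poly_pcompose)
      with e show ?case by blast
    qed
    let ?env = "[encode (f x), encode x]"
    have var: "eval ?P ?env (EVar 0) (encode (f x)) 1" "eval ?P ?env (EVar 1) (encode x) 1"
      using eval_evals.eval_var[of 0 ?env] eval_evals.eval_var[of 1 ?env] by auto
    have args: "evals ?P ?env [EVar 0, EVar 1] ?env (1 + (1 + 0))"
      using var by (intro eval_evals.evals_cons eval_evals.evals_nil)
    let ?v = "foldr (g x) (f x) (z x)" and ?b = "p + m + (p + 1) * b + [:10:]"
    let ?e = "ELet ef (ECall ?r [EVar 0, EVar 1])"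
    obtain l where l: "eval ?P ?env body (encode ?v) l" "l \<le> (length (f x) + 1) * poly b ?n"
      using rec[of "f x"] by auto
    have "eval ?P [encode x] ?e (encode ?v) (t + (2 + l + 1) + 1)"
      using l(1) by (intro eval_evals.eval_let[OF eval_extend[OF t(1)]]
          eval_cong[OF eval_evals.eval_call[OF args, of ?r]]) auto
    moreover have "l \<le> (poly p ?n + 1) * poly b ?n"
      using l(2) by (rule order_trans) (intro mult_mono, use len in auto)
    ultimately show "\<exists>t. eval ?P [encode x] ?e (encode ?v) t \<and>
        t \<le> poly ?b ?n \<and> esize ?v \<le> poly ?b ?n"
      using t(2) acc[of "f x"] by (intro exI conjI) (assumption, auto)
  qed
qed


text \<open>A boolean accumulator has size at most 1, so the growth hypothesis is automatic.\<close>

lemma polytime_foldr_bool: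
  fixes f :: "'a::encodable \<Rightarrow> 'b::encodable list"
  assumes "polytime f" "polytime z" "polytime (\<lambda>u. g (fst u) (fst (snd u)) (snd (snd u)))"
  shows "polytime (\<lambda>x. foldr (g x) (f x) (z x :: bool))"
proof (rule polytime_foldr[OF assms, of "[:1:]"])
  show "esize (g x y acc) \<le> esize acc + poly [:1:] (esize x)" for x y acc
    using esize_bool[of "g x y acc"] by simp
qed

lemma polytime_list_all [polytime_intros]:
  assumes "polytime f" "polytime (\<lambda>z. g (fst z) (snd z))"
  shows "polytime (\<lambda>x. list_all (g x) (f x))"
proof -
  have "list_all h ys = foldr (\<lambda>y acc. h y \<and> acc) ys True" for h :: "'b \<Rightarrow> bool" and ys
    by (induction ys) auto
  moreover have "polytime (\<lambda>x. foldr (\<lambda>y acc. g x y \<and> acc) (f x) True)"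
    by (intro polytime_foldr_bool polytime_intros assms polytime_comp2[OF assms(2)])
  ultimately show ?thesis by simp
qed

lemma polytime_list_ex [polytime_intros]:
  assumes "polytime f" "polytime (\<lambda>z. g (fst z) (snd z))"
  shows "polytime (\<lambda>x. list_ex (g x) (f x))"
proof -
  have "list_ex h ys = (\<not> list_all (\<lambda>y. \<not> h y) ys)" for h :: "'b \<Rightarrow> bool" and ys
    by (induction ys) auto
  moreover have "polytime (\<lambda>x. \<not> list_all (\<lambda>y. \<not> g x y) (f x))"
    by (intro polytime_intros assms)
  ultimately show ?thesis by simp
qed

lemma polytime_esize:
  assumes "polytime f"
  obtains p where "\<And>x. esize (f x) \<le> poly p (esize x)"
  using assms unfolding polytime_def implements_def by metis

lemma polytime_map [polytime_intros]:
  assumes "polytime f" "polytime (\<lambda>z. g (fst z) (snd z))"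
  shows "polytime (\<lambda>x. map (g x) (f x))"
proof -
  obtain p where p: "\<And>x. esize (f x) \<le> poly p (esize x)"
    using polytime_esize[OF assms(1)] by blast
  obtain q where q: "\<And>z. esize (g (fst z) (snd z)) \<le> poly q (esize z)"
    using polytime_esize[OF assms(2)] by blast
  have growth: "esize (g x y # acc) \<le> esize acc + poly (1 + pcompose q ([:1, 1:] + p)) (esize x)"
    if "y \<in> set (f x)" for x y acc
  proof -
    have "poly q (esize (x, y)) \<le> poly q (esize x + poly p (esize x) + 1)"
      using p[of x] esize_member[OF that] by (intro poly_nat_mono) auto
    then show ?thesis using q[of "(x, y)"] by (simp add: poly_pcompose algebra_simps)
  qed
  have "polytime (\<lambda>x. foldr (\<lambda>y acc. g x y # acc) (f x) [])"
    by (rule polytime_foldr[OF _ _ _ growth])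
      (intro polytime_intros assms(1) polytime_comp2[OF assms(2)])+
  moreover have "map h ys = foldr (\<lambda>y acc. h y # acc) ys []" for h :: "'b \<Rightarrow> 'c" and ys
    by (induction ys) auto
  ultimately show ?thesis by simp
qed

lemma polytime_filter [polytime_intros]:
  assumes "polytime f" "polytime (\<lambda>z. g (fst z) (snd z))"
  shows "polytime (\<lambda>x. filter (g x) (f x))"
proof -
  obtain p where p: "\<And>x. esize (f x) \<le> poly p (esize x)"
    using polytime_esize[OF assms(1)] by blast
  have growth: "esize (if g x y then y # acc else acc) \<le> esize acc + poly p (esize x)"
    if "y \<in> set (f x)" for x y acc
    using p[of x] esize_member[OF that] by auto
  have "polytime (\<lambda>x. foldr (\<lambda>y acc. if g x y then y # acc else acc) (f x) [])"
    by (rule polytime_foldr[OF _ _ _ growth])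
      (intro polytime_intros assms(1) polytime_comp2[OF assms(2)])+
  moreover have "filter h ys = foldr (\<lambda>y acc. if h y then y # acc else acc) ys []"
    for h :: "'b \<Rightarrow> bool" and ys
    by (induction ys) auto
  ultimately show ?thesis by simp
qed

lemma polytime_append [polytime_intros]:
  assumes "polytime f" "polytime g"
  shows "polytime (\<lambda>x. f x @ g x)"
proof -
  obtain p where p: "\<And>x. esize (f x) \<le> poly p (esize x)"
    using polytime_esize[OF assms(1)] by blast
  have growth: "esize (y # acc) \<le> esize acc + poly p (esize x)"
    if "y \<in> set (f x)" for x y acc
    using p[of x] esize_member[OF that] by auto
  have "polytime (\<lambda>x. foldr (\<lambda>y acc. y # acc) (f x) (g x))"
    by (rule polytime_foldr[OF _ _ _ growth]) (intro polytime_intros assms)+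
  moreover have "foldr (#) ys zs = ys @ zs" for ys zs :: "'b list"
    by (induction ys) auto
  ultimately show ?thesis by simp
qed

lemma esize_append: "esize (xs @ ys) = esize xs + esize ys"
  by (induction xs) auto

lemma polytime_concat [polytime_intros]:
  assumes "polytime f"
  shows "polytime (\<lambda>x. concat (f x))"
proof -
  obtain p where p: "\<And>x. esize (f x) \<le> poly p (esize x)"
    using polytime_esize[OF assms] by blast
  have growth: "esize (y @ acc) \<le> esize acc + poly p (esize x)"
    if "y \<in> set (f x)" for x y acc
    using p[of x] esize_member[OF that] by (auto simp: esize_append)
  have "polytime (\<lambda>x. foldr (\<lambda>y acc. y @ acc) (f x) [])"
    by (rule polytime_foldr[OF _ _ _ growth]) (intro polytime_intros assms)+
  then show ?thesis by (simp add: concat_conv_foldr)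
qed

lemma polytime_rev [polytime_intros]:
  assumes "polytime f"
  shows "polytime (\<lambda>x. rev (f x))"
proof -
  obtain p where p: "\<And>x. esize (f x) \<le> poly p (esize x)"
    using polytime_esize[OF assms] by blast
  have growth: "esize (acc @ [y]) \<le> esize acc + poly p (esize x)"
    if "y \<in> set (f x)" for x y acc
    using p[of x] esize_member[OF that] by (auto simp: esize_append)
  have "polytime (\<lambda>x. foldr (\<lambda>y acc. acc @ [y]) (f x) [])"
    by (rule polytime_foldr[OF _ _ _ growth]) (intro polytime_intros assms)+
  moreover have "rev ys = foldr (\<lambda>y acc. acc @ [y]) ys []" for ys :: "'b list"
    by (induction ys) auto
  ultimately show ?thesis by simp
qed

text \<open>A fold consumes one list only, so the second list travels in the accumulator and loses
  its head in each round. As \<open>foldr\<close> starts at the last element, the first list is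
  reversed beforehand; the pairs pile up backwards and are reversed afterwards.\<close>

lemma polytime_zip [polytime_intros]:
  fixes f :: "'a::encodable \<Rightarrow> 'b::encodable list" and g :: "'a \<Rightarrow> 'c::encodable list"
  assumes "polytime f" "polytime g"
  shows "polytime (\<lambda>x. zip (f x) (g x))"
proof -
  define step where "step y (st :: 'c list \<times> ('b \<times> 'c) list) =
    (case fst st of [] \<Rightarrow> st | c # cs \<Rightarrow> (cs, (y, c) # snd st))" for y st
  obtain p where p: "\<And>x. esize (rev (f x)) \<le> poly p (esize x)"
    using polytime_esize[OF polytime_rev[OF assms(1)]] by blast
  have growth: "esize (step y st) \<le> esize st + poly (p + 2) (esize x)"
    if "y \<in> set (rev (f x))" for x y st
    using p[of x] esize_member[OF that]
    by (cases st) (auto simp: step_def split: list.split)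
  have fold: "foldr step (rev ys) (zs, acc) = (drop (length ys) zs, rev (zip ys zs) @ acc)" for ys zs acc
    unfolding foldr_conv_fold rev_rev_ident
  proof (induction ys arbitrary: zs acc)
    case (Cons y ys)
    then show ?case by (cases zs) (auto simp: step_def)
  qed simp
  have "polytime (\<lambda>x. rev (snd (foldr step (rev (f x)) (g x, []))))"
    by (intro polytime_rev polytime_snd polytime_foldr[OF _ _ _ growth])
      (intro polytime_intros assms | unfold step_def)+
  then show ?thesis by (simp add: fold)
qed

section \<open>The pinned consistency algorithm\<close>

text \<open>A constraint is a tuple of the left structure paired with the list of tuples its image may
  take; a partial assignment is a list of argument-value pairs that need not be functional.\<close>

type_synonym ('a, 'b) constraint = "'a list \<times> 'b list list"
type_synonym ('a, 'b) assignment = "('a \<times> 'b) list"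

text \<open>In particular \<open>compatible w w\<close> says that \<open>w\<close> is a partial
  function.\<close>

definition compatible :: "('a, 'b) assignment \<Rightarrow> ('a, 'b) assignment \<Rightarrow> bool" where
  "compatible v w \<longleftrightarrow> list_all (\<lambda>(a, b). list_all (\<lambda>(a', b'). a = a' \<longrightarrow> b = b') w) v"

text \<open>One group per sequence of \<open>k\<close> constraints, holding all their joint choices of image tuples.\<close>

fun groups :: "nat \<Rightarrow> ('a, 'b) constraint list \<Rightarrow> ('a, 'b) assignment list list" where
  "groups 0 cs = [[[]]]"
| "groups (Suc k) cs =
     concat (map (\<lambda>G. map (\<lambda>(t, R). concat (map (\<lambda>w. map (\<lambda>s. zip t s @ w) R) G)) cs) (groups k cs))"

definition refine :: "('a, 'b) assignment list list \<Rightarrow> ('a, 'b) assignment list list" where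
  "refine S = map (filter (\<lambda>w. list_all (list_ex (compatible w)) S)) S"

text \<open>The single test on \<open>w @ p\<close> says that \<open>w\<close> and \<open>p\<close>
  are functional and that they agree with each other.\<close>

definition initial :: "nat \<Rightarrow> ('a, 'b) constraint list \<Rightarrow> ('a, 'b) assignment \<Rightarrow> ('a, 'b) assignment list list" where
  "initial k cs p = map (filter (\<lambda>w. compatible (w @ p) (w @ p))) (groups k cs)"

text \<open>The list \<open>concat S\<close> acts as a counter: a round that changes anything
  deletes a choice, so as many rounds as there are choices reach a fixed point.\<close>

definition consistent :: "nat \<Rightarrow> ('a, 'b) constraint list \<Rightarrow> ('a, 'b) assignment \<Rightarrow> bool" where
  "consistent k cs p \<longleftrightarrow>
     (let S = initial k cs p in list_all (\<lambda>G. G \<noteq> []) (foldr (\<lambda>_. refine) (concat S) S))"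

text \<open>The boolean records whether every argument so far has found a value. A fold cannot stop
  early, so after a failure the state is passed on unchanged.\<close>

definition pin_step ::
    "nat \<Rightarrow> ('a, 'b) constraint list \<Rightarrow> 'b list \<Rightarrow> 'a \<Rightarrow> bool \<times> ('a, 'b) assignment \<Rightarrow> bool \<times> ('a, 'b) assignment" where
  "pin_step k cs bs a st =
     (if fst st
      then case filter (\<lambda>b. consistent k cs ((a, b) # snd st)) bs of
          [] \<Rightarrow> (False, snd st)
        | b # _ \<Rightarrow> (True, (a, b) # snd st)
      else st)"

definition constraints :: "'a list list list \<Rightarrow> 'b list list list \<Rightarrow> ('a, 'b) constraint list" where
  "constraints rs rs' = concat (map (\<lambda>(ts, R). map (\<lambda>t. (t, R)) ts) (zip rs rs'))"

text \<open>The case \<open>bs = []\<close> is singled out because the consistency test does not see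
  arguments that lie in no constraint, and such arguments have no image in an empty
  universe.\<close>

definition solve :: "nat \<Rightarrow> nat list \<Rightarrow> nat list \<Rightarrow> (nat, nat) constraint list \<Rightarrow> answer" where
  "solve k us bs cs =
     (if \<not> consistent k cs [] then Unsatisfiable
      else let st = foldr (pin_step k cs bs) us (True, []) in
        if fst st then Assignment (snd st) else if bs = [] then Unsatisfiable else Dont_Know)"

type_synonym listed_structure = "nat list \<times> nat list list list"

definition solve_input :: "nat \<Rightarrow> nat list \<times> listed_structure \<times> listed_structure \<Rightarrow> answer" where
  "solve_input k = (\<lambda>(\<sigma>, (us, rs), (bs, rs')). solve k us bs (constraints rs rs'))"


subsection \<open>Running time\<close>

lemma polytime_compatible [polytime_intros]:
  assumes "polytime f" "polytime g"
  shows "polytime (\<lambda>x. compatible (f x) (g x))"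
  by (rule polytime_comp2[OF _ assms]) (unfold compatible_def, intro polytime_intros)

text \<open>This is where \<open>k\<close> being fixed matters: the induction on \<open>k\<close>
  takes place outside the machine, adds one composition per level, and lets the polynomial depend on
  \<open>k\<close>.\<close>

lemma polytime_groups [polytime_intros]:
  assumes "polytime f"
  shows "polytime (\<lambda>x. groups k (f x))"
proof (rule polytime_comp[OF _ assms])
  show "polytime (groups k)"
  proof (induction k)
    case 0
    then show ?case by (simp add: polytime_const)
  next
    case (Suc k)
    show ?case
      unfolding groups.simps by (intro polytime_intros polytime_comp[OF Suc])
  qed
qed

lemma esize_filter_le: "esize (filter P xs) \<le> esize xs"
  by (induction xs) auto

lemma esize_refine_le: "esize (refine S :: ('a::encodable, 'b::encodable) assignment list list) \<le> esize S"
proof -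
  have "esize (map (filter P) T) \<le> esize T" for P and T :: "('a::encodable, 'b::encodable) assignment list list"
    by (induction T) (auto intro: add_mono esize_filter_le)
  then show ?thesis unfolding refine_def .
qed

lemma polytime_initial [polytime_intros]:
  assumes "polytime f" "polytime g"
  shows "polytime (\<lambda>x. initial k (f x) (g x))"
  by (rule polytime_comp2[OF _ assms]) (unfold initial_def, intro polytime_intros)

lemma polytime_refine [polytime_intros]:
  assumes "polytime f"
  shows "polytime (\<lambda>x. refine (f x))"
  by (rule polytime_comp[OF _ assms]) (unfold refine_def, intro polytime_intros)

text \<open>Refinement only filters, so the accumulator of the fold never grows and the growth bound
  can be \<open>q = 0\<close>.\<close>

lemma polytime_consistent [polytime_intros]:
  assumes "polytime f" "polytime g"
  shows "polytime (\<lambda>x. consistent k (f x) (g x))"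
  by (rule polytime_comp2[OF _ assms])
    (unfold consistent_def, intro polytime_intros polytime_foldr[where q = 0],
     simp add: esize_refine_le)

text \<open>A round adds at most one pair. Its parts occur in the two input lists, and two new cells
  are spent on it; hence the growth bound \<open>[:2, 1:]\<close>.\<close>

lemma polytime_pin:
  "polytime (\<lambda>z :: ('a::encodable, 'b::encodable) constraint list \<times> 'b list \<times> 'a list.
    foldr (pin_step k (fst z) (fst (snd z))) (snd (snd z)) (True, []))"
proof (rule polytime_foldr)
  show "polytime (\<lambda>u. pin_step k (fst (fst u)) (fst (snd (fst u))) (fst (snd u)) (snd (snd u)))"
    unfolding pin_step_def by (intro polytime_intros)
  fix z :: "('a, 'b) constraint list \<times> 'b list \<times> 'a list" and a st
  assume a: "a \<in> set (snd (snd z))"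
  obtain cs bs us where z: "z = (cs, bs, us)" by (cases z)
  show "esize (pin_step k (fst z) (fst (snd z)) a st) \<le> esize st + poly [:2, 1:] (esize z)"
  proof (cases "filter (\<lambda>b. consistent k cs ((a, b) # snd st)) bs")
    case Nil
    then show ?thesis by (cases st) (auto simp: pin_step_def z)
  next
    case (Cons b l)
    then have "b \<in> set (filter (\<lambda>b. consistent k cs ((a, b) # snd st)) bs)" by simp
    then have "b \<in> set bs" by simp
    from esize_member[OF this] esize_member[OF a] Cons show ?thesis
      by (cases st) (auto simp: pin_step_def z)
  qed
qed (intro polytime_intros)+

lemma polytime_constraints [polytime_intros]:
  assumes "polytime f" "polytime g"
  shows "polytime (\<lambda>x. constraints (f x) (g x))"
  by (rule polytime_comp2[OF _ assms]) (unfold constraints_def, intro polytime_intros)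

lemma polytime_solve_input: "polytime (solve_input k)"
  unfolding solve_input_def solve_def case_prod_beta
  by (intro polytime_intros
      polytime_comp3[where h = "\<lambda>cs bs us. foldr (pin_step k cs bs) us (True, [])", OF polytime_pin])

text \<open>A run starts at the head of the program, so the main expression becomes function 0 and
  the table moves up by one.\<close>

lemma polytime_program:
  fixes f :: "'a::encodable \<Rightarrow> 'b::encodable"
  assumes "polytime f"
  obtains P p where "\<And>x. \<exists>t. runs P (encode x) (encode (f x)) t \<and> t \<le> poly p (esize x)"
proof -
  obtain Q e p where f: "implements Q e p f" using assms polytime_def by blast
  let ?P = "shift 1 e # map (shift 1) Q"
  have "\<exists>t. runs ?P (encode x) (encode (f x)) t \<and> t \<le> poly p (esize x)" for x
  proof -
    obtain t where t: "eval Q [encode x] e (encode (f x)) t" "t \<le> poly p (esize x)"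
      using f by (rule implementsE)
    with eval_shift(1)[OF t(1), of "[shift 1 e]"] show ?thesis by (auto simp: runs_def)
  qed
  then show thesis by (rule that)
qed

section \<open>Soundness and stability of the refinement\<close>

lemma compatible_iff:
  "compatible v w \<longleftrightarrow> (\<forall>a b b'. (a, b) \<in> set v \<longrightarrow> (a, b') \<in> set w \<longrightarrow> b = b')"
  unfolding compatible_def list_all_iff by fastforce

lemma compatible_sym: "compatible v w \<Longrightarrow> compatible w v"
  unfolding compatible_iff by blast

fun joins :: "('a, 'b) constraint list \<Rightarrow> ('a, 'b) assignment list" where
  "joins [] = [[]]"
| "joins ((t, R) # c) = concat (map (\<lambda>w. map (\<lambda>s. zip t s @ w) R) (joins c))"

text \<open>\<open>groups\<close> keeps only the choices. This recovers the sequence behind each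
  group, so that a group can be addressed by its constraints.\<close>

lemma groups_eq: "groups k cs = map joins (List.n_lists k cs)"
  by (induction k) (auto simp: map_concat intro!: arg_cong[where f = concat])

lemma joins_sound:
  assumes "\<forall>(t, R)\<in>set c. map h t \<in> set R"
  shows "\<exists>w\<in>set (joins c). \<forall>(a, b)\<in>set w. b = h a"
  using assms
proof (induction c rule: joins.induct)
  case (2 t R c)
  then obtain w where "w \<in> set (joins c)" "\<forall>(a, b)\<in>set w. b = h a" by auto
  moreover have "\<forall>(a, b)\<in>set (zip t (map h t)). b = h a" by (auto simp: in_set_zip)
  ultimately have "zip t (map h t) @ w \<in> set (joins ((t, R) # c))"
      "\<forall>(a, b)\<in>set (zip t (map h t) @ w). b = h a"
    using 2 by auto
  then show ?case by blast
qed simp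

lemma joins_contains:
  assumes "w \<in> set (joins c)" "(t, R) \<in> set c"
  obtains s where "s \<in> set R" "set (zip t s) \<subseteq> set w"
proof -
  have "\<exists>s\<in>set R. set (zip t s) \<subseteq> set w"
    using assms
  proof (induction c arbitrary: w rule: joins.induct)
    case (2 t' R' c)
    then obtain w' s' where w: "w' \<in> set (joins c)" "s' \<in> set R'" "w = zip t' s' @ w'" by auto
    show ?case
    proof (cases "(t, R) \<in> set c")
      case True
      then show ?thesis using 2 w by fastforce
    next
      case False
      then show ?thesis using 2 w by auto
    qed
  qed simp
  with that show thesis by blast
qed

lemma joins_covered:
  assumes "w \<in> set (joins c)" "(a, b) \<in> set w"
  obtains t R s where "(t, R) \<in> set c" "s \<in> set R" "a \<in> set t" "b \<in> set s"
proof -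
  have "\<exists>(t, R)\<in>set c. \<exists>s\<in>set R. a \<in> set t \<and> b \<in> set s"
    using assms
  proof (induction c arbitrary: w rule: joins.induct)
    case (2 t R c)
    then obtain w' s where w: "w' \<in> set (joins c)" "s \<in> set R" "w = zip t s @ w'" by auto
    show ?case
    proof (cases "(a, b) \<in> set w'")
      case True
      then show ?thesis using 2 w by fastforce
    next
      case False
      then show ?thesis using 2 w by (auto dest: set_zip_leftD set_zip_rightD)
    qed
  qed simp
  with that show thesis by blast
qed

lemma foldr_refine: "foldr (\<lambda>_. refine) l S = (refine ^^ length l) S"
  by (induction l) auto

text \<open>If filtering leaves the total length unchanged, then no group has lost an
  element.\<close>

lemma refine_decreases:
  assumes "refine S \<noteq> S"
  shows "length (concat (refine S)) < length (concat S)"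
proof -
  have le: "length (concat (map (filter P) T)) \<le> length (concat T)"
    for P and T :: "('a, 'b) assignment list list"
    by (induction T) (auto intro: add_mono)
  have eq: "map (filter P) T = T" if "length (concat (map (filter P) T)) = length (concat T)"
    for P and T :: "('a, 'b) assignment list list"
    using that
  proof (induction T)
    case (Cons G T)
    then have "length (filter P G) = length G" "length (concat (map (filter P) T)) = length (concat T)"
      using length_filter_le[of P G] le[of P T] by (simp_all del: length_filter_le)
    moreover from this(1) have "filter P G = G"
      by (metis filter_True length_filter_less order_less_irrefl)
    ultimately show ?case using Cons.IH by simp
  qed simp
  show ?thesis
    using assms le eq unfolding refine_def by (metis le_neq_implies_less)
qed

lemma refine_stable:
  assumes "length (concat S) \<le> n"
  shows "refine ((refine ^^ n) S) = (refine ^^ n) S"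
  using assms
proof (induction n arbitrary: S)
  case 0
  then have "\<not> length (concat (refine S)) < length (concat S)" by linarith
  then have "refine S = S" using refine_decreases by blast
  then show ?case by simp
next
  case (Suc n)
  show ?case
  proof (cases "refine S = S")
    case True
    then have "(refine ^^ m) S = S" for m by (induction m) auto
    with True show ?thesis by simp
  next
    case False
    then have "length (concat (refine S)) \<le> n" using refine_decreases[of S] Suc.prems by simp
    from Suc.IH[OF this] show ?thesis by (simp add: funpow_swap1)
  qed
qed

text \<open>Every round applies the same test in all groups. Survival is therefore a property of the
  choice and not of the group it sits in, and the survivors can be collected in one set.\<close>

lemma funpow_refine_filter:
  obtains P where "(refine ^^ n) (map (filter Q) L) = map (filter (\<lambda>w. Q w \<and> P w)) L"
proof -
  have "\<exists>P. (refine ^^ n) (map (filter Q) L) = map (filter (\<lambda>w. Q w \<and> P w)) L"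
  proof (induction n)
    case 0
    show ?case by (rule exI[of _ "\<lambda>_. True"]) simp
  next
    case (Suc n)
    then obtain P where P: "(refine ^^ n) (map (filter Q) L) = map (filter (\<lambda>w. Q w \<and> P w)) L"
      by blast
    then have "(refine ^^ Suc n) (map (filter Q) L) =
        map (filter (\<lambda>w. list_all (list_ex (compatible w)) (map (filter (\<lambda>w. Q w \<and> P w)) L)))
          (map (filter (\<lambda>w. Q w \<and> P w)) L)"
      by (simp add: refine_def)
    also have "\<dots> = map (filter (\<lambda>w. Q w \<and> P w \<and>
        list_all (list_ex (compatible w)) (map (filter (\<lambda>w. Q w \<and> P w)) L))) L"
      by (simp add: conj_ac)
    finally show ?case
      by (intro exI[of _ "\<lambda>w. P w \<and> list_all (list_ex (compatible w)) (map (filter (\<lambda>w. Q w \<and> P w)) L)"])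
  qed
  then show thesis using that by blast
qed

text \<open>A consistent instance has a winning strategy for the cover game: a set \<open>S\<close> of joint
  choices, compatible with the pins, that can answer every challenge by \<open>k\<close> constraints.\<close>

lemma consistentE:
  assumes "consistent k cs p"
  obtains S where
    "\<And>c. c \<in> set (List.n_lists k cs) \<Longrightarrow> \<exists>w\<in>S. w \<in> set (joins c)"
    "\<And>w c. w \<in> S \<Longrightarrow> c \<in> set (List.n_lists k cs) \<Longrightarrow>
       \<exists>w'\<in>S. w' \<in> set (joins c) \<and> compatible w w'"
    "\<And>w. w \<in> S \<Longrightarrow> compatible (w @ p) (w @ p)"
proof -
  define S where "S = initial k cs p"
  define T where "T = (refine ^^ length (concat S)) S"
  have nonempty: "list_all (\<lambda>G. G \<noteq> []) T"
    using assms by (simp add: consistent_def S_def T_def foldr_refine Let_def)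
  obtain P' where "T = map (filter (\<lambda>w. compatible (w @ p) (w @ p) \<and> P' w)) (groups k cs)"
    unfolding T_def S_def initial_def by (rule funpow_refine_filter)
  then obtain P where T: "T = map (filter P) (map joins (List.n_lists k cs))"
    and P: "\<And>w. P w \<Longrightarrow> compatible (w @ p) (w @ p)"
    unfolding groups_eq by blast
  have stable: "refine T = T" unfolding T_def by (rule refine_stable) simp
  show thesis
  proof
    let ?S = "{w \<in> (\<Union>c\<in>set (List.n_lists k cs). set (joins c)). P w}"
    show "\<exists>w\<in>?S. w \<in> set (joins c)" if "c \<in> set (List.n_lists k cs)" for c
    proof -
      have "\<exists>w\<in>set (joins c). P w"
        using nonempty that unfolding T by (auto simp: list_all_iff filter_empty_conv)
      then show ?thesis using that by blast
    qed
    show "\<exists>w'\<in>?S. w' \<in> set (joins c') \<and> compatible w w'"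
      if w: "w \<in> ?S" and c': "c' \<in> set (List.n_lists k cs)" for c' w
    proof -
      obtain c where c: "c \<in> set (List.n_lists k cs)" "w \<in> set (joins c)" "P w"
        using w by blast
      have "filter P (joins c) \<in> set T" using c(1) by (auto simp: T)
      \<comment> \<open>At a fixed point the filter of \<open>refine\<close> removes nothing from
        any group, so every survivor passes its test.\<close>
      moreover have "\<forall>G\<in>set T. filter (\<lambda>w. list_all (list_ex (compatible w)) T) G = G"
        using stable unfolding refine_def by (metis map_eq_conv list.map_ident)
      moreover have "w \<in> set (filter P (joins c))" using c(2,3) by simp
      ultimately have "w \<in> set (filter (\<lambda>w. list_all (list_ex (compatible w)) T) (filter P (joins c)))"
        by metis
      then have "list_all (list_ex (compatible w)) T" by simp
      moreover have "filter P (joins c') \<in> set T" using c' by (auto simp: T)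
      ultimately have "list_ex (compatible w) (filter P (joins c'))" by (simp add: list_all_iff)
      then have "\<exists>w'\<in>set (joins c'). P w' \<and> compatible w w'" by (auto simp: list_ex_iff)
      then show ?thesis using c' by blast
    qed
    show "compatible (w @ p) (w @ p)" if "w \<in> ?S" for w using that P by blast
  qed
qed

lemma consistentI:
  assumes h: "\<forall>(t, R)\<in>set cs. map h t \<in> set R" and p: "\<forall>(a, b)\<in>set p. b = h a"
  shows "consistent k cs p"
proof -
  \<comment> \<open>The invariant: each group retains a choice that follows \<open>h\<close>. Any
    two such choices are compatible, so they protect each other from deletion.\<close>
  let ?ok = "\<lambda>S. \<forall>G\<in>set S. \<exists>w\<in>set G. \<forall>(a, b)\<in>set w. b = h a"
  have compatible: "compatible v w" if "\<forall>(a, b)\<in>set v. b = h a" "\<forall>(a, b)\<in>set w. b = h a" for v w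
    using that unfolding compatible_iff by fastforce
  have "?ok (initial k cs p)"
  proof
    fix G assume "G \<in> set (initial k cs p)"
    then obtain c where c: "set c \<subseteq> set cs" "G = filter (\<lambda>w. compatible (w @ p) (w @ p)) (joins c)"
      by (auto simp: initial_def groups_eq set_n_lists)
    then obtain w where "w \<in> set (joins c)" "\<forall>(a, b)\<in>set w. b = h a"
      using joins_sound[of c h] h by blast
    moreover from this p have "compatible (w @ p) (w @ p)" by (intro compatible) auto
    ultimately show "\<exists>w\<in>set G. \<forall>(a, b)\<in>set w. b = h a" using c by auto
  qed
  moreover have "?ok (refine S)" if ok: "?ok S" for S
    unfolding refine_def
  proof
    fix G assume "G \<in> set (map (filter (\<lambda>w. list_all (list_ex (compatible w)) S)) S)"
    then obtain G' where G: "G' \<in> set S" "G = filter (\<lambda>w. list_all (list_ex (compatible w)) S) G'"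
      by auto
    then obtain w where "w \<in> set G'" "\<forall>(a, b)\<in>set w. b = h a" using ok by blast
    moreover from this have "list_all (list_ex (compatible w)) S"
      using ok compatible unfolding list_all_iff list_ex_iff by blast
    ultimately show "\<exists>w\<in>set G. \<forall>(a, b)\<in>set w. b = h a" using G by auto
  qed
  ultimately have "?ok ((refine ^^ n) (initial k cs p))" for n
    by (induction n) auto
  then show ?thesis
    by (fastforce simp: consistent_def foldr_refine list_all_iff Let_def)
qed

section \<open>Choices along a tree\<close>

text \<open>When the new first vertex already lies on the path, the suffix starting there is taken
  instead, which cuts out the loop.\<close>

lemma rtrancl_distinct_path:
  assumes "(u, x) \<in> r\<^sup>*" "r \<subseteq> S \<times> S" "x \<in> S"
  shows "\<exists>p. p \<noteq> [] \<and> hd p = u \<and> last p = x \<and> distinct p \<and> set p \<subseteq> S \<and>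
    (\<forall>i. Suc i < length p \<longrightarrow> (p ! i, p ! Suc i) \<in> r)"
  using assms(1)
proof (induction rule: converse_rtrancl_induct)
  case base
  show ?case by (rule exI[of _ "[x]"]) (use assms in auto)
next
  case (step y z)
  then obtain p where p: "p \<noteq> []" "hd p = z" "last p = x" "distinct p" "set p \<subseteq> S"
    "\<forall>i. Suc i < length p \<longrightarrow> (p ! i, p ! Suc i) \<in> r" by blast
  show ?case
  proof (cases "y \<in> set p")
    case True
    then obtain as bs where eq: "p = as @ y # bs" by (auto dest: split_list)
    have "(\<forall>i. Suc i < length (y # bs) \<longrightarrow> ((y # bs) ! i, (y # bs) ! Suc i) \<in> r)"
    proof (intro allI impI)
      fix i assume "Suc i < length (y # bs)"
      then show "((y # bs) ! i, (y # bs) ! Suc i) \<in> r"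
        using p(6)[rule_format, of "length as + i"] by (simp add: eq nth_append)
    qed
    then show ?thesis using p by (intro exI[of _ "y # bs"]) (auto simp: eq)
  next
    case False
    have "((y # p) ! i, (y # p) ! Suc i) \<in> r" if "Suc i < length (y # p)" for i
      using that p step(1) by (cases i) (auto simp: hd_conv_nth)
    then show ?thesis using p False step(1) assms(2) by (intro exI[of _ "y # p"]) auto
  qed
qed

text \<open>A simple path inside \<open>S\<close> between the two neighbours \<open>u\<close> and
  \<open>x\<close> closes to a cycle through \<open>v\<close>.\<close>

lemma two_neighbours_cycle:
  assumes "connected_in E S" "u \<in> S" "x \<in> S" "u \<noteq> x" "v \<notin> S" "{u, v} \<in> E" "{v, x} \<in> E"
  shows "\<exists>c. is_cycle E c"
proof -
  let ?r = "{(x, y). x \<in> S \<and> y \<in> S \<and> {x, y} \<in> E}"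
  have "(u, x) \<in> ?r\<^sup>*" using assms unfolding connected_in_def by blast
  then obtain p where p: "p \<noteq> []" "hd p = u" "last p = x" "distinct p" "set p \<subseteq> S"
    "\<forall>i. Suc i < length p \<longrightarrow> (p ! i, p ! Suc i) \<in> ?r"
    using rtrancl_distinct_path[of u x ?r S] assms by auto
  \<comment> \<open>As \<open>u\<close> and \<open>x\<close> differ, the path has at least two
    vertices, and the cycle has the required length of three.\<close>
  obtain a b q where q: "p = a # b # q"
    using p assms(4) by (metis hd_Cons_tl last_ConsL)
  have "{(p @ [v]) ! i, (p @ [v]) ! Suc i} \<in> E" if "Suc i < length (p @ [v])" for i
  proof (cases "Suc i < length p")
    case True
    then show ?thesis using p(6) by (simp add: nth_append)
  next
    case False
    with that have "Suc i = length p" by simp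
    then show ?thesis
      using p(1,3) assms(7)
      by (auto simp: nth_append last_conv_nth insert_commute simp flip: \<open>Suc i = length p\<close>)
  qed
  then have "is_cycle E (p @ [v])"
    unfolding is_cycle_def using p assms q by (auto simp: insert_commute)
  then show ?thesis by blast
qed

text \<open>The vertex \<open>u\<close> serves as a hub: every vertex reaches it and is reached from
  it.\<close>

lemma connected_in_insert:
  assumes "connected_in E S" "u \<in> S" "{u, v} \<in> E"
  shows "connected_in E (insert v S)"
proof -
  let ?r = "\<lambda>S. {(x, y). x \<in> S \<and> y \<in> S \<and> {x, y} \<in> E}"
  have mono: "(?r S)\<^sup>* \<subseteq> (?r (insert v S))\<^sup>*" by (rule rtrancl_mono) auto
  have "(x, u) \<in> (?r (insert v S))\<^sup>* \<and> (u, x) \<in> (?r (insert v S))\<^sup>*" if "x \<in> insert v S" for x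
  proof (cases "x = v")
    case True
    have "{v, u} \<in> E" using assms(3) by (simp add: insert_commute)
    then show ?thesis using True assms by (auto intro!: r_into_rtrancl)
  next
    case False
    then show ?thesis using that assms mono unfolding connected_in_def by blast
  qed
  then show ?thesis unfolding connected_in_def by (meson rtrancl_trans)
qed

lemma connected_in_crossing:
  assumes "connected_in E V" "S \<subseteq> V" "S \<noteq> {}" "S \<noteq> V"
  shows "\<exists>u v. u \<in> S \<and> v \<in> V - S \<and> {u, v} \<in> E"
proof (rule ccontr)
  assume *: "\<not> ?thesis"
  obtain x y where xy: "x \<in> S" "y \<in> V - S" using assms by blast
  then have "(x, y) \<in> {(x, y). x \<in> V \<and> y \<in> V \<and> {x, y} \<in> E}\<^sup>*"
    using assms unfolding connected_in_def by blast
  then have "y \<in> S" by (induction rule: rtrancl_induct) (use xy * in auto)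
  then show False using xy by blast
qed

text \<open>The tree is explored from a root; by acyclicity a newly reached vertex has just one explored
  neighbour, so its choice only has to match one earlier choice.\<close>

lemma tree_choice:
  assumes tree: "is_tree V E"
    and start: "\<And>v. v \<in> V \<Longrightarrow> \<exists>w. Q v w"
    and extend: "\<And>u v w. u \<in> V \<Longrightarrow> v \<in> V \<Longrightarrow> Q u w \<Longrightarrow> \<exists>w'. Q v w' \<and> R w w'"
    and sym: "\<And>w w'. R w w' \<Longrightarrow> R w' w"
  shows "\<exists>W. (\<forall>v\<in>V. Q v (W v)) \<and> (\<forall>u\<in>V. \<forall>v\<in>V. {u, v} \<in> E \<longrightarrow> R (W u) (W v))"
proof -
  define good where "good S W \<longleftrightarrow> S \<subseteq> V \<and> connected_in E S \<and> (\<forall>v\<in>S. Q v (W v)) \<and>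
      (\<forall>u\<in>S. \<forall>v\<in>S. {u, v} \<in> E \<longrightarrow> R (W u) (W v))" for S W
  have fin: "finite V" and ne: "V \<noteq> {}" and conn: "connected_in E V"
    and acyclic: "\<nexists>c. is_cycle E c"
    using tree unfolding is_tree_def by blast+
  \<comment> \<open>\<open>R\<close> is not assumed to be reflexive, so loops have to be
    excluded.\<close>
  have irrefl: "{v, v} \<notin> E" for v
  proof
    assume "{v, v} \<in> E"
    then obtain x y where "{v, v} = {x, y}" "x \<noteq> y" using tree unfolding is_tree_def by blast
    then show False by (simp add: doubleton_eq_iff)
  qed
  have "\<exists>S W. card S = Suc n \<and> good S W" if "n < card V" for n
    using that
  proof (induction n)
    case 0
    obtain r w where "r \<in> V" "Q r w" using ne start by blast
    moreover have "connected_in E {r}" by (simp add: connected_in_def)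
    ultimately have "good {r} (\<lambda>_. w)" using irrefl[of r] by (simp add: good_def)
    moreover have "card {r} = Suc 0" by simp
    ultimately show ?case by blast
  next
    case (Suc n)
    then have "\<exists>S W. card S = Suc n \<and> good S W" by simp
    then obtain S W where card: "card S = Suc n" and "good S W" by blast
    then have S: "S \<subseteq> V" "connected_in E S" "\<forall>v\<in>S. Q v (W v)"
      "\<forall>u\<in>S. \<forall>v\<in>S. {u, v} \<in> E \<longrightarrow> R (W u) (W v)"
      unfolding good_def by blast+
    have "S \<noteq> V" "S \<noteq> {}" using card Suc.prems by auto
    with S(1) obtain u v where uv: "u \<in> S" "v \<in> V" "v \<notin> S" "{u, v} \<in> E"
      using connected_in_crossing[OF conn] by blast
    have "u \<in> V" "Q u (W u)" using uv(1) S(1,3) by auto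
    from extend[OF this(1) uv(2) this(2)] obtain w where w: "Q v w" "R (W u) w" by blast
    have "x = u" if "x \<in> S" "{v, x} \<in> E" for x
      using two_neighbours_cycle[OF S(2) uv(1) that(1) _ uv(3,4) that(2)] acyclic by blast
    then have "R w (W x)" "R (W x) w" if "x \<in> S" "{v, x} \<in> E" for x
      using that w(2) sym by auto
    then have "\<forall>x\<in>insert v S. \<forall>y\<in>insert v S.
        {x, y} \<in> E \<longrightarrow> R ((W(v := w)) x) ((W(v := w)) y)"
      using S(4) uv(3) irrefl[of v] by (auto simp: insert_commute[of _ v])
    moreover have "\<forall>x\<in>insert v S. Q x ((W(v := w)) x)" using S(3) w(1) by simp
    ultimately have "good (insert v S) (W(v := w))"
      using S(1) uv(2) connected_in_insert[OF S(2) uv(1,4)] unfolding good_def by blast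
    moreover have "card (insert v S) = Suc (Suc n)"
      using card S(1) uv(3) fin by (simp add: finite_subset)
    ultimately show ?case by blast
  qed
  moreover obtain n where n: "card V = Suc n"
    using fin ne by (metis card_eq_0_iff not0_implies_Suc)
  ultimately obtain S W where SW: "card S = card V" "good S W" by fastforce
  then have "S = V" using fin by (simp add: card_subset_eq good_def)
  then show ?thesis using SW(2) unfolding good_def by blast
qed

section \<open>Instances of bounded coverwidth\<close>

lemma hyperedge_subset:
  assumes "finite_structure \<sigma> A" "e \<in> hyperedges A"
  shows "e \<subseteq> univ A"
  using assms unfolding hyperedges_def finite_structure_def by auto

lemma finite_hyperedges:
  assumes "finite_structure \<sigma> A"
  shows "finite (hyperedges A)"
proof -
  have "hyperedges A \<subseteq> Pow (univ A)"
    using hyperedge_subset[OF assms] by blast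
  then show ?thesis using assms finite_subset unfolding finite_structure_def by blast
qed

lemma is_tree_singleton: "is_tree {v} {}"
  by (auto simp: is_tree_def connected_in_def is_cycle_def)

lemma coverwidth_attained:
  assumes "finite_structure \<sigma> A"
  obtains V :: "nat set" and E X
  where "tree_decomposition A V E X" "coverwidth A = decomposition_weight A V X"
proof -
  \<comment> \<open>The one-node tree whose bag is the whole universe shows that the minimum is over
    a nonempty set.\<close>
  have "tree_decomposition A {0 :: nat} {} (\<lambda>_. univ A)"
    using hyperedge_subset[OF assms]
    by (simp add: tree_decomposition_def is_tree_singleton connected_in_def)
  then have "\<exists>w (V :: nat set) E X. tree_decomposition A V E X \<and> w = decomposition_weight A V X"
    by blast
  from LeastI_ex[OF this, folded coverwidth_def] show thesis using that by blast
qed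

lemma weight_cover:
  assumes "finite H" "weight H X \<le> k"
  obtains F where "F \<subseteq> H" "card F \<le> k" "X \<inter> \<Union>H \<subseteq> \<Union>F"
proof -
  let ?P = "\<lambda>k. \<exists>U. is_k_union H k U \<and> X \<inter> \<Union>H \<subseteq> U"
  have "is_k_union H (card H) (\<Union>H)"
    using assms(1) unfolding is_k_union_def by blast
  then have "?P (card H)" by blast
  then have "?P (weight H X)" unfolding weight_def by (rule LeastI[of ?P])
  then obtain F where "F \<subseteq> H" "card F = weight H X" "X \<inter> \<Union>H \<subseteq> \<Union>F"
    unfolding is_k_union_def by blast
  then show thesis using that assms(2) by simp
qed

text \<open>Groups belong to sequences of exactly \<open>k\<close> constraints, whereas a cover may
  be smaller and a hyperedge may come from several constraints. One preimage is picked per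
  hyperedge, and the list is padded with an arbitrary element.\<close>

lemma list_cover:
  assumes "finite F" "card F \<le> k" "F \<subseteq> f ` S" "S \<noteq> {}"
  obtains l where "length l = k" "set l \<subseteq> S" "F \<subseteq> f ` set l"
proof -
  obtain S' where S': "S' \<subseteq> S" "inj_on f S'" "F = f ` S'"
    using assms(3) unfolding subset_image_inj by blast
  then have "finite S'" "card S' \<le> k"
    using assms(1,2) by (auto simp: finite_image_iff card_image)
  then obtain l0 where l0: "set l0 = S'" "length l0 \<le> k"
    using finite_distinct_list[of S'] distinct_card by fastforce
  obtain y where "y \<in> S" using assms(4) by blast
  show thesis
    by (rule that[of "l0 @ replicate (k - length l0) y"])
      (use l0 S' \<open>y \<in> S\<close> in auto)
qed

section \<open>Structures and instances given by lists\<close>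

definition lists_structure :: "'a list \<Rightarrow> 'a list list list \<Rightarrow> 'a rel_structure \<Rightarrow> bool" where
  "lists_structure us rs A \<longleftrightarrow> set us = univ A \<and> list_all2 (\<lambda>ts R. set ts = R) rs (rels A)"

lemma constraints_iff:
  assumes "finite_structure \<sigma> A" "finite_structure \<sigma> B" "lists_structure us rs A"
    "lists_structure bs rs' B"
  shows "(t, R) \<in> set (constraints rs rs') \<longleftrightarrow>
    (\<exists>i < length \<sigma>. t \<in> rels A ! i \<and> R = rs' ! i)"
proof -
  have len: "length rs = length \<sigma>" "length rs' = length \<sigma>"
    using assms unfolding lists_structure_def finite_structure_def
    by (metis list_all2_lengthD)+
  have nth: "set (rs ! i) = rels A ! i" if "i < length \<sigma>" for i
    using assms(3) that len by (auto simp: lists_structure_def list_all2_conv_all_nth)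
  have "(t, R) \<in> set (constraints rs rs') \<longleftrightarrow> (\<exists>ts. (ts, R) \<in> set (zip rs rs') \<and> t \<in> set ts)"
    by (auto simp: constraints_def)
  also have "\<dots> \<longleftrightarrow> (\<exists>i < length \<sigma>. t \<in> set (rs ! i) \<and> R = rs' ! i)"
    by (auto simp: in_set_zip len)
  also have "\<dots> \<longleftrightarrow> (\<exists>i < length \<sigma>. t \<in> rels A ! i \<and> R = rs' ! i)"
    using nth by blast
  finally show ?thesis .
qed

locale listed_instance =
  fixes \<sigma> and A :: "'a rel_structure" and B :: "'b rel_structure" and us rs bs rs'
  assumes A: "finite_structure \<sigma> A" "lists_structure us rs A"
    and B: "finite_structure \<sigma> B" "lists_structure bs rs' B"
begin

abbreviation cs :: "('a, 'b) constraint list" where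
  "cs \<equiv> constraints rs rs'"

lemma sets: "set us = univ A" "set bs = univ B"
  using A B by (auto simp: lists_structure_def)

lemma nth_rels: "i < length \<sigma> \<Longrightarrow> set (rs' ! i) = rels B ! i"
  using B by (auto simp: lists_structure_def finite_structure_def list_all2_conv_all_nth)

lemmas constraint_iff = constraints_iff[OF A(1) B(1) A(2) B(2)]

lemma constraintD:
  assumes "(t, R) \<in> set cs"
  shows "set t \<in> hyperedges A" "set t \<subseteq> univ A"
    "s \<in> set R \<Longrightarrow> length s = length t" "s \<in> set R \<Longrightarrow> set s \<subseteq> univ B"
proof -
  obtain i where i: "i < length \<sigma>" "t \<in> rels A ! i" "R = rs' ! i"
    using assms constraint_iff by blast
  have "set R = rels B ! i" using i nth_rels by simp
  with i A(1) B(1) show "set t \<subseteq> univ A" "s \<in> set R \<Longrightarrow> length s = length t"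
    "s \<in> set R \<Longrightarrow> set s \<subseteq> univ B"
    by (simp_all add: finite_structure_def)
  show "set t \<in> hyperedges A"
    using i A(1) unfolding hyperedges_def finite_structure_def by auto
qed

lemma hyperedge_constraint: "hyperedges A = (\<lambda>(t, R). set t) ` set cs"
proof -
  have "length (rels A) = length \<sigma>" using A(1) by (simp add: finite_structure_def)
  then have "e \<in> hyperedges A \<longleftrightarrow> (\<exists>t R. (t, R) \<in> set cs \<and> e = set t)" for e
    unfolding hyperedges_def constraint_iff by auto
  then show ?thesis by auto
qed

text \<open>The condition on \<open>univ A\<close> remains separate because some arguments may lie
  in no constraint.\<close>

lemma homomorphism_iff:
  "homomorphism A B h \<longleftrightarrow> h ` univ A \<subseteq> univ B \<and> (\<forall>(t, R)\<in>set cs. map h t \<in> set R)"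
proof -
  have len: "length (rels A) = length \<sigma>" using A(1) by (simp add: finite_structure_def)
  have "(\<forall>(t, R)\<in>set cs. map h t \<in> set R) \<longleftrightarrow> (\<forall>t R. (t, R) \<in> set cs \<longrightarrow> map h t \<in> set R)"
    by auto
  also have "\<dots> \<longleftrightarrow> (\<forall>i<length \<sigma>. \<forall>t\<in>rels A ! i. map h t \<in> rels B ! i)"
    unfolding constraint_iff using nth_rels by blast
  finally show ?thesis unfolding homomorphism_def len by blast
qed

lemma consistent_homomorphism:
  assumes "homomorphism A B h" "\<forall>(a, b)\<in>set p. b = h a"
  shows "consistent k cs p"
  using assms consistentI[of cs h p k] by (simp add: homomorphism_iff)

text \<open>For a constraint \<open>(t, R)\<close>, a surviving choice for the sequence repeating it
  \<open>k\<close> times contains a row \<open>s\<close> of \<open>R\<close> placed along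
  \<open>t\<close>. The pins give a value to every argument of \<open>t\<close>, so compatibility
  forces \<open>s\<close> to be the image of \<open>t\<close>.\<close>

lemma consistent_total_assignment:
  assumes "k \<ge> 1" "consistent k cs p" "distinct us" "map fst p = us" "snd ` set p \<subseteq> univ B"
  shows "homomorphism A B (\<lambda>a. the (map_of p a))"
proof -
  have p: "(a, the (map_of p a)) \<in> set p" if "a \<in> univ A" for a
  proof -
    have "a \<in> fst ` set p" using that sets(1) assms(4) by (metis image_set)
    then obtain b where "map_of p a = Some b" by (metis domD dom_map_of_conv_image_fst)
    then show ?thesis by (simp add: map_of_SomeD)
  qed
  obtain S where S: "\<And>c. c \<in> set (List.n_lists k cs) \<Longrightarrow> \<exists>w\<in>S. w \<in> set (joins c)"
    "\<And>w c. w \<in> S \<Longrightarrow> c \<in> set (List.n_lists k cs) \<Longrightarrow>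
       \<exists>w'\<in>S. w' \<in> set (joins c) \<and> compatible w w'"
    "\<And>w. w \<in> S \<Longrightarrow> compatible (w @ p) (w @ p)"
    using consistentE[OF assms(2)] by metis
  have "map (\<lambda>a. the (map_of p a)) t \<in> set R" if tR: "(t, R) \<in> set cs" for t R
  proof -
    let ?c = "replicate k (t, R)"
    have "?c \<in> set (List.n_lists k cs)" using tR by (auto simp: set_n_lists)
    then obtain w where w: "w \<in> set (joins ?c)" "w \<in> S" using S(1) by blast
    obtain s where s: "s \<in> set R" "set (zip t s) \<subseteq> set w"
      using joins_contains[OF w(1), of t R] assms(1) by auto
    have len: "length s = length t" by (rule constraintD(3)[OF tR s(1)])
    have "s = map (\<lambda>a. the (map_of p a)) t"
    proof (rule nth_equalityI)
      fix j assume j: "j < length s"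
      have "(t ! j, s ! j) \<in> set (zip t s)" using j len by (auto simp: set_zip)
      then have "(t ! j, s ! j) \<in> set (w @ p)" using s(2) by auto
      moreover have "t ! j \<in> univ A" using constraintD(2)[OF tR] j len by auto
      then have "(t ! j, the (map_of p (t ! j))) \<in> set (w @ p)" using p by simp
      ultimately have "s ! j = the (map_of p (t ! j))"
        using S(3)[OF w(2)] unfolding compatible_iff by blast
      then show "s ! j = map (\<lambda>a. the (map_of p a)) t ! j" using j len by simp
    qed (simp add: len)
    with s(1) show ?thesis by simp
  qed
  moreover have "the (map_of p a) \<in> univ B" if "a \<in> univ A" for a
    using p[OF that] assms(5) by force
  ultimately show ?thesis unfolding homomorphism_iff by blast
qed

text \<open>A cover by at most \<open>k\<close> hyperedges is padded to a sequence of
  \<open>k\<close> constraints, which requires that some constraint exists.\<close>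

lemma bag_cover:
  assumes "weight (hyperedges A) Y \<le> k" "cs \<noteq> []"
  obtains c where "c \<in> set (List.n_lists k cs)" "Y \<inter> \<Union>(hyperedges A) \<subseteq> (\<Union>(t, R)\<in>set c. set t)"
proof -
  obtain F where F: "F \<subseteq> hyperedges A" "card F \<le> k" "Y \<inter> \<Union>(hyperedges A) \<subseteq> \<Union>F"
    using weight_cover[OF finite_hyperedges[OF A(1)] assms(1)] by blast
  have "finite F" "set cs \<noteq> {}"
    using F(1) finite_hyperedges[OF A(1)] finite_subset assms(2) by auto
  from list_cover[OF this(1) F(2) F(1)[unfolded hyperedge_constraint] this(2)]
  obtain c where c: "length c = k" "set c \<subseteq> set cs" "F \<subseteq> (\<lambda>(t, R). set t) ` set c" .
  show thesis
  proof (rule that)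
    show "c \<in> set (List.n_lists k cs)" using c(1,2) by (simp add: set_n_lists)
    show "Y \<inter> \<Union>(hyperedges A) \<subseteq> (\<Union>(t, R)\<in>set c. set t)"
      using F(3) Union_mono[OF c(3)] by (rule order_trans)
  qed
qed

text \<open>A constraint inside a bag is satisfied by the glued map because the choice at this bag is
  compatible with some surviving choice for the sequence repeating that constraint.\<close>

lemma coverwidth_complete:
  assumes "k \<ge> 1" "coverwidth A \<le> k" "consistent k cs p" "compatible p p"
    "snd ` set p \<subseteq> univ B" "univ B \<noteq> {}"
  obtains h where "homomorphism A B h" "\<forall>(a, b)\<in>set p. b = h a"
proof (cases "cs = []")
  case True
  \<comment> \<open>Without constraints there is no sequence of length \<open>k\<close> to cover a
    bag with, but any map extending the pins is a homomorphism; \<open>b0\<close> fills the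
    arguments that are not pinned.\<close>
  obtain b0 where b0: "b0 \<in> univ B" using assms(6) by blast
  define h where "h a = (case map_of p a of None \<Rightarrow> b0 | Some b \<Rightarrow> b)" for a
  have "h a \<in> univ B" for a
    using b0 assms(5) by (auto simp: h_def split: option.split dest!: map_of_SomeD)
  moreover have "b = h a" if ab: "(a, b) \<in> set p" for a b
  proof -
    obtain b' where "map_of p a = Some b'" using ab by (metis weak_map_of_SomeI)
    then show ?thesis
      using ab assms(4) map_of_SomeD[of p a b'] by (auto simp: h_def compatible_iff)
  qed
  ultimately show thesis using that[of h] True unfolding homomorphism_iff by auto
next
  case False
  let ?H = "hyperedges A"
  obtain V :: "nat set" and E X where dec: "tree_decomposition A V E X"
    and width: "coverwidth A = decomposition_weight A V X"
    using coverwidth_attained[OF A(1)] by blast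
  have tree: "is_tree V E" and bags: "\<And>e. e \<in> ?H \<Longrightarrow> \<exists>v\<in>V. e \<subseteq> X v"
    and conn: "\<And>a. a \<in> univ A \<Longrightarrow> connected_in E {v \<in> V. a \<in> X v}"
    using dec unfolding tree_decomposition_def by blast+
  have "weight ?H (X v) \<le> k" if "v \<in> V" for v
  proof -
    have "weight ?H (X v) \<le> decomposition_weight A V X"
      unfolding decomposition_weight_def using tree that by (intro Max_ge) (auto simp: is_tree_def)
    then show ?thesis using width assms(2) by simp
  qed
  then have "\<exists>c. c \<in> set (List.n_lists k cs) \<and> X v \<inter> \<Union>?H \<subseteq> (\<Union>(t, R)\<in>set c. set t)"
    if "v \<in> V" for v
    using bag_cover[OF _ False] that by blast
  then obtain c where c: "\<And>v. v \<in> V \<Longrightarrow> c v \<in> set (List.n_lists k cs)"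
    "\<And>v. v \<in> V \<Longrightarrow> X v \<inter> \<Union>?H \<subseteq> (\<Union>(t, R)\<in>set (c v). set t)"
    by metis
  have c_sub: "set (c v) \<subseteq> set cs" if "v \<in> V" for v using c(1)[OF that] by (auto simp: set_n_lists)
  obtain S where S: "\<And>c. c \<in> set (List.n_lists k cs) \<Longrightarrow> \<exists>w\<in>S. w \<in> set (joins c)"
    "\<And>w c. w \<in> S \<Longrightarrow> c \<in> set (List.n_lists k cs) \<Longrightarrow>
       \<exists>w'\<in>S. w' \<in> set (joins c) \<and> compatible w w'"
    "\<And>w. w \<in> S \<Longrightarrow> compatible (w @ p) (w @ p)"
    using consistentE[OF assms(3)] by metis
  have "\<exists>W. (\<forall>v\<in>V. W v \<in> S \<inter> set (joins (c v))) \<and>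
      (\<forall>u\<in>V. \<forall>v\<in>V. {u, v} \<in> E \<longrightarrow> compatible (W u) (W v))"
  proof (rule tree_choice[OF tree, where Q = "\<lambda>v w. w \<in> S \<inter> set (joins (c v))"])
    show "\<exists>w. w \<in> S \<inter> set (joins (c v))" if "v \<in> V" for v using S(1) c(1)[OF that] by blast
    show "\<exists>w'. w' \<in> S \<inter> set (joins (c v)) \<and> compatible w w'"
      if "u \<in> V" "v \<in> V" "w \<in> S \<inter> set (joins (c u))" for u v w
      using S(2)[OF _ c(1)[OF that(2)]] that(3) by blast
  qed (rule compatible_sym)
  then obtain W where W: "\<And>v. v \<in> V \<Longrightarrow> W v \<in> set (joins (c v))" "\<And>v. v \<in> V \<Longrightarrow> W v \<in> S"
    "\<And>u v. u \<in> V \<Longrightarrow> v \<in> V \<Longrightarrow> {u, v} \<in> E \<Longrightarrow> compatible (W u) (W v)"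
    by auto
  \<comment> \<open>The constraints of \<open>c v\<close> cover the bag, so the choice at
    \<open>v\<close> gives a value to each argument of the bag that lies in some hyperedge.\<close>
  have dom: "\<exists>b. (a, b) \<in> set (W v)" if v: "v \<in> V" and a: "a \<in> X v" "a \<in> \<Union>?H" for a v
  proof -
    obtain t R where tR: "(t, R) \<in> set (c v)" "a \<in> set t" using c(2)[OF v] a by blast
    obtain s where s: "s \<in> set R" "set (zip t s) \<subseteq> set (W v)"
      using joins_contains[OF W(1)[OF v] tR(1)] by blast
    have "length s = length t" using constraintD(3) c_sub[OF v] tR(1) s(1) by blast
    then have "a \<in> set (map fst (zip t s))" using tR(2) by simp
    then show ?thesis using s(2) by auto
  qed
  have rng: "a \<in> \<Union>?H \<and> b \<in> univ B" if v: "v \<in> V" and ab: "(a, b) \<in> set (W v)" for a b v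
  proof -
    obtain t R s where "(t, R) \<in> set (c v)" "s \<in> set R" "a \<in> set t" "b \<in> set s"
      using joins_covered[OF W(1)[OF v] ab] by metis
    then show ?thesis using c_sub[OF v] constraintD(1,4)[of t R] by blast
  qed
  \<comment> \<open>The bags containing \<open>a\<close> form a connected subtree. Along a path in
    it each bag has a value for \<open>a\<close> by \<open>dom\<close>, and compatibility of
    neighbours carries the value on.\<close>
  have agree: "b = b'"
    if "u \<in> V" "v \<in> V" "a \<in> X u" "a \<in> X v" "(a, b) \<in> set (W u)" "(a, b') \<in> set (W v)" for u v a b b'
  proof -
    have aH: "a \<in> \<Union>?H" using rng[OF that(1,5)] by simp
    then have "a \<in> univ A" using constraintD(2) unfolding hyperedge_constraint by blast
    then have "(u, v) \<in> {(x, y). x \<in> {v \<in> V. a \<in> X v} \<and> y \<in> {v \<in> V. a \<in> X v} \<and> {x, y} \<in> E}\<^sup>*"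
      using conn that(1-4) unfolding connected_in_def by blast
    then have "\<forall>b'. (a, b') \<in> set (W v) \<longrightarrow> b = b'"
    proof (induction rule: rtrancl_induct)
      case base
      then show ?case using S(3)[OF W(2)[OF that(1)]] that(5) unfolding compatible_iff by auto
    next
      case (step x y)
      then have xy: "x \<in> V" "y \<in> V" "a \<in> X x" "{x, y} \<in> E" by auto
      obtain b'' where "(a, b'') \<in> set (W x)" using dom[OF xy(1,3) aH] by blast
      then show ?case using step.IH W(3)[OF xy(1,2,4)] unfolding compatible_iff by blast
    qed
    then show ?thesis using that(6) by blast
  qed
  \<comment> \<open>The restriction to \<open>a \<in> X v\<close> is essential: the constraints
    covering a bag may reach outside it, and choices at distant nodes need not agree there.\<close>
  define D where "D a b \<longleftrightarrow> (\<exists>v\<in>V. a \<in> X v \<and> (a, b) \<in> set (W v)) \<or> (a, b) \<in> set p" for a b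
  have D_fun: "b = b'" if "D a b" "D a b'" for a b b'
  proof -
    have "b = b'" if "v \<in> V" "(a, b) \<in> set (W v)" "(a, b') \<in> set p" for v b b'
      using S(3)[OF W(2)[OF that(1)]] that(2,3) unfolding compatible_iff by auto
    moreover have "b = b'" if "(a, b) \<in> set p" "(a, b') \<in> set p"
      using assms(4) that unfolding compatible_iff by blast
    ultimately show ?thesis using that agree unfolding D_def by metis
  qed
  \<comment> \<open>Arguments that are neither pinned nor in any hyperedge receive the default value
    \<open>b0\<close>.\<close>
  obtain b0 where b0: "b0 \<in> univ B" using assms(6) by blast
  define h where "h a = (if \<exists>b. D a b then SOME b. D a b else b0)" for a
  have h: "h a = b" if "D a b" for a b
    using D_fun someI[of "D a" b] that by (auto simp: h_def)
  have D_B: "b \<in> univ B" if "D a b" for a b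
    using that rng assms(5) unfolding D_def by force
  have "h a \<in> univ B" for a
  proof (cases "\<exists>b. D a b")
    case True
    then show ?thesis using h D_B by metis
  next
    case False
    then show ?thesis using b0 by (simp add: h_def)
  qed
  moreover have "map h t \<in> set R" if tR: "(t, R) \<in> set cs" for t R
  proof -
    obtain v where v: "v \<in> V" "set t \<subseteq> X v" using bags constraintD(1)[OF tR] by blast
    let ?c = "replicate k (t, R)"
    have "?c \<in> set (List.n_lists k cs)" using tR by (auto simp: set_n_lists)
    then obtain w where w: "w \<in> set (joins ?c)" "compatible (W v) w"
      using S(2)[OF W(2)[OF v(1)]] by blast
    obtain s where s: "s \<in> set R" "set (zip t s) \<subseteq> set w"
      using joins_contains[OF w(1), of t R] assms(1) by auto
    have len: "length s = length t" by (rule constraintD(3)[OF tR s(1)])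
    have "s = map h t"
    proof (rule nth_equalityI)
      fix j assume j: "j < length s"
      have "(t ! j, s ! j) \<in> set (zip t s)" using j len by (auto simp: set_zip)
      then have ts: "(t ! j, s ! j) \<in> set w" and t: "t ! j \<in> set t"
        using s(2) j len by auto
      then obtain b where b: "(t ! j, b) \<in> set (W v)"
        using dom[OF v(1), of "t ! j"] v(2) constraintD(1)[OF tR] by blast
      then have "b = s ! j" using w(2) ts unfolding compatible_iff by blast
      then have "D (t ! j) (s ! j)" using b v t unfolding D_def by blast
      then show "s ! j = map h t ! j" using h j len by simp
    qed (simp add: len)
    with s(1) show ?thesis by simp
  qed
  moreover have "\<forall>(a, b)\<in>set p. b = h a" using h by (auto simp: D_def)
  ultimately show thesis using that[of h] unfolding homomorphism_iff by blast
qed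

end

section \<open>The pinning loop and the correctness of its answers\<close>

lemma compatible_self: "distinct (map fst p) \<Longrightarrow> compatible p p"
  unfolding compatible_iff using eq_key_imp_eq_value by metis

lemma (in listed_instance) pin_loop_sound:
  assumes "consistent k cs []" "foldr (pin_step k cs bs) l (True, []) = (True, p)"
  shows "map fst p = l \<and> snd ` set p \<subseteq> univ B \<and> consistent k cs p"
  using assms(2)
proof (induction l arbitrary: p)
  case Nil
  then show ?case using assms(1) by simp
next
  case (Cons a l)
  obtain ok q where q: "foldr (pin_step k cs bs) l (True, []) = (ok, q)" by fastforce
  let ?bs = "filter (\<lambda>b. consistent k cs ((a, b) # q)) bs"
  have step: "pin_step k cs bs a (ok, q) = (True, p)" using Cons.prems q by simp
  then have ok: ok and "?bs \<noteq> []" by (auto simp: pin_step_def split: if_splits)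
  then obtain b r where b: "?bs = b # r" by (cases ?bs) auto
  then have "b \<in> set ?bs" by simp
  moreover have "p = (a, b) # q" using step ok b by (simp add: pin_step_def)
  ultimately show ?case using Cons.IH[of q] q ok sets(2) by auto
qed

text \<open>The pins chosen so far pass the test, hence extend to a homomorphism, and its value at
  the next argument passes again.\<close>

lemma (in listed_instance) pin_loop_complete:
  assumes "k \<ge> 1" "coverwidth A \<le> k" "univ B \<noteq> {}" "consistent k cs []"
    "distinct l" "set l \<subseteq> univ A"
  shows "fst (foldr (pin_step k cs bs) l (True, []))"
  using assms(5,6)
proof (induction l)
  case (Cons a l)
  then have "fst (foldr (pin_step k cs bs) l (True, []))" by simp
  then obtain p where p: "foldr (pin_step k cs bs) l (True, []) = (True, p)"
    by (cases "foldr (pin_step k cs bs) l (True, [])") simp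
  note sound = pin_loop_sound[OF assms(4) p]
  have "compatible p p" using sound Cons.prems(1) by (intro compatible_self) simp
  then obtain h where h: "homomorphism A B h" "\<forall>(a, b)\<in>set p. b = h a"
    using coverwidth_complete[OF assms(1,2) _ _ _ assms(3), of p] sound by blast
  \<comment> \<open>The loop may choose a value other than \<open>h a\<close>; it is enough that
    some value passes, as a new homomorphism is obtained in each round.\<close>
  have "consistent k cs ((a, h a) # p)" using h by (intro consistent_homomorphism[of h]) auto
  moreover have "h a \<in> set bs"
    using h(1) Cons.prems(2) sets(2) unfolding homomorphism_def by auto
  ultimately have "filter (\<lambda>b. consistent k cs ((a, b) # p)) bs \<noteq> []"
    by (auto simp: filter_empty_conv)
  then have "fst (pin_step k cs bs a (True, p))" by (auto simp: pin_step_def split: list.split)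
  then show ?case using p by simp
qed simp

lemma solve_correct:
  assumes inst: "listed_instance \<sigma> A B us rs bs rs'" and "distinct us" "k \<ge> 1"
  defines "ans \<equiv> solve k us bs (constraints rs rs')"
  shows "correct_answer (\<sigma>, A, B) ans \<and> (coverwidth A \<le> k \<longrightarrow> ans \<noteq> Dont_Know)"
proof -
  interpret listed_instance \<sigma> A B us rs bs rs' by (rule inst)
  obtain ok p where p: "foldr (pin_step k cs bs) us (True, []) = (ok, p)" by fastforce
  have ans: "ans = (if \<not> consistent k cs [] then Unsatisfiable else if ok then Assignment p
      else if bs = [] then Unsatisfiable else Dont_Know)"
    by (simp add: ans_def solve_def p)
  consider (inconsistent) "\<not> consistent k cs []" | (found) "consistent k cs []" ok
    | (empty) "consistent k cs []" "\<not> ok" "bs = []" | (stuck) "consistent k cs []" "\<not> ok" "bs \<noteq> []"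
    by blast
  then show ?thesis
  proof cases
    case inconsistent
    then have "\<not> satisfiable (\<sigma>, A, B)" using consistent_homomorphism by fastforce
    then show ?thesis using inconsistent ans by simp
  next
    case found
    then have "map fst p = us" "snd ` set p \<subseteq> univ B" "consistent k cs p"
      using pin_loop_sound p by auto
    then have "satisfying_assignment (\<sigma>, A, B) p"
      using consistent_total_assignment assms(2,3) sets(1) by (simp add: satisfying_assignment_def)
    then show ?thesis using found ans by simp
  next
    case empty
    \<comment> \<open>On an empty list the loop succeeds, so some argument exists, and it has no
      possible image.\<close>
    have "us \<noteq> []" using empty(2) p by auto
    then have "\<not> satisfiable (\<sigma>, A, B)"
      using sets empty(3) by (cases us) (auto simp: homomorphism_def)
    then show ?thesis using empty ans by simp
  next
    case stuck
    have "univ B \<noteq> {}" using stuck(3) sets(2) by (metis set_empty)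
    then have "\<not> coverwidth A \<le> k"
      using pin_loop_complete[of k us] assms(2,3) sets(1) p stuck(1,2) by auto
    then show ?thesis using stuck ans by simp
  qed
qed

section \<open>From encoded inputs to lists\<close>

lemma encodes_instance_listed:
  assumes "(\<sigma>, A, B) \<in> CSP" "encodes_instance (\<sigma>, A, B) x"
  obtains us rs bs rs' where "x = encode (\<sigma>, (us, rs), (bs, rs'))" "distinct us"
    "listed_instance \<sigma> A B us rs bs rs'"
proof -
  have listed: "\<exists>us rs. x = encode (us, rs) \<and> distinct us \<and> lists_structure us rs A"
    if "encodes_structure A x" for A x
  proof -
    obtain us rs where "distinct us" "set us = univ A"
      "list_all2 (\<lambda>ts R. distinct ts \<and> set ts = R) rs (rels A)"
      "x = Node (enc_list enc_nat us) (enc_list (enc_list (enc_list enc_nat)) rs)"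
      using \<open>encodes_structure A x\<close> unfolding encodes_structure_def by blast
    moreover from this(3) have "list_all2 (\<lambda>ts R. set ts = R) rs (rels A)"
      by (rule list_all2_mono) simp
    ultimately have "x = encode (us, rs) \<and> distinct us \<and> lists_structure us rs A"
      by (simp add: lists_structure_def encode_list_def encode_nat_def)
    then show ?thesis by blast
  qed
  obtain a b where "x = Node (enc_list enc_nat \<sigma>) (Node a b)"
    and ab: "encodes_structure A a" "encodes_structure B b"
    using assms(2) by auto
  then have x: "x = Node (encode \<sigma>) (Node a b)" by (simp add: encode_list_def encode_nat_def)
  obtain us rs where a: "a = encode (us, rs)" "distinct us" "lists_structure us rs A"
    using listed[OF ab(1)] by blast
  obtain bs rs' where b: "b = encode (bs, rs')" "lists_structure bs rs' B"
    using listed[OF ab(2)] by blast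
  show thesis
  proof (rule that)
    show "x = encode (\<sigma>, (us, rs), (bs, rs'))" using x a(1) b(1) by simp
    show "listed_instance \<sigma> A B us rs bs rs'"
      using assms(1) a(3) b(2) by (simp add: listed_instance_def CSP_def)
  qed (rule a(2))
qed

theorem theorem7:
  fixes k :: nat
  assumes "k \<ge> 1"
  shows "\<exists>P :: program.
    polynomial_time_on {x. \<exists>I\<in>CSP. encodes_instance I x} P \<and>
    (\<forall>I\<in>CSP. \<forall>x. encodes_instance I x \<longrightarrow>
      (\<exists>ans t. runs P x (enc_answer ans) t \<and> correct_answer I ans \<and>
        (I \<in> CSP_coverwidth_le k \<longrightarrow> ans \<noteq> Dont_Know)))"
proof -
  \<comment> \<open>An input tree is literally the encoding of a tuple of lists, so this bound is
    already one in the size of the input.\<close>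
  obtain P p where P: "\<And>z. \<exists>t. runs P (encode z) (encode (solve_input k z)) t \<and> t \<le> poly p (esize z)"
    using polytime_program[OF polytime_solve_input] by blast
  have "polynomial_time_on {x. \<exists>I\<in>CSP. encodes_instance I x} P"
    unfolding polynomial_time_on_def
  proof (intro exI[of _ p] ballI)
    fix x assume "x \<in> {x. \<exists>I\<in>CSP. encodes_instance I x}"
    then obtain I where I: "I \<in> CSP" "encodes_instance I x" by blast
    obtain \<sigma> A B where "I = (\<sigma>, A, B)" by (cases I)
    with I have "(\<sigma>, A, B) \<in> CSP" "encodes_instance (\<sigma>, A, B) x" by simp_all
    then obtain us bs :: "nat list" and rs rs' :: "nat list list list"
      where "x = encode (\<sigma>, (us, rs), (bs, rs'))"
      by (rule encodes_instance_listed)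
    then show "\<exists>y t. runs P x y t \<and> t \<le> poly p (size x)" using P by blast
  qed
  moreover have "\<exists>ans t. runs P x (enc_answer ans) t \<and> correct_answer I ans \<and>
      (I \<in> CSP_coverwidth_le k \<longrightarrow> ans \<noteq> Dont_Know)"
    if I: "I \<in> CSP" "encodes_instance I x" for I x
  proof -
    obtain \<sigma> A B where I_eq: "I = (\<sigma>, A, B)" by (cases I)
    obtain us rs bs rs' where x: "x = encode (\<sigma>, (us, rs), (bs, rs'))" and "distinct us"
      and inst: "listed_instance \<sigma> A B us rs bs rs'"
      using I unfolding I_eq by (rule encodes_instance_listed)
    let ?ans = "solve k us bs (constraints rs rs')"
    have "\<exists>t. runs P x (enc_answer ?ans) t"
      using P[of "(\<sigma>, (us, rs), (bs, rs'))"] unfolding x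
      by (auto simp: solve_input_def encode_answer_def)
    then show ?thesis
      using solve_correct[OF inst \<open>distinct us\<close> assms]
      by (auto simp: I_eq CSP_coverwidth_le_def)
  qed
  ultimately show ?thesis by blast
qed

end
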